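(* Let $\Gamma$ be a finite simple graph, $A_\Gamma$ the associated right-angled Artin group, and $\phi\in\mathrm{Aut}(A_\Gamma)$ a length-preserving automorphism of finite order $m$. Then the conjugacy problem is solvable for the group $$A_\phi = A_\Gamma \rtimes_\phi \mathbb{Z}/m\mathbb{Z} = \langle V(\Gamma), t \mid [s,s']=1 \ (\{s,s'\}\in E(\Gamma)),\ t^m = 1,\ t^{-1}xt = \phi(x)\ (x\in V(\Gamma))\rangle.$$
   Context: The right-angled Artin group of $\Gamma$ is $A_\Gamma = \langle V(\Gamma) \mid [s,t]=1 \text{ for all } \{s,t\}\in E(\Gamma)\rangle$. With $X = V(\Gamma)\cup V(\Gamma)^{-1}$ and $|g|$ the word length of $g$ over $X$, $\phi$ is length-preserving if $|\phi(g)|=|g|$ for all $g\in A_\Gamma$. The conjugacy problem for a finitely presented group $G$ with generating set $Y$ asks for an algorithm that, given two words over $Y\cup Y^{-1}$, decides whether they represent conjugate elements of $G$. *)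

theory Defs
  imports Main "HOL-Library.Nat_Bijection"
begin

text \<open>A letter is a generator together with a sign (True = positive, False = inverse).\<close>
type_synonym 'g letter = "'g \<times> bool"

definition inv_letter :: "'g letter \<Rightarrow> 'g letter" where
  "inv_letter a = (fst a, \<not> snd a)"

definition inv_word :: "'g letter list \<Rightarrow> 'g letter list" where
  "inv_word w = rev (map inv_letter w)"

definition word_over :: "'g set \<Rightarrow> 'g letter list \<Rightarrow> bool" where
  "word_over A w \<longleftrightarrow> (\<forall>a \<in> set w. fst a \<in> A)"

inductive pres_eq :: "'g letter list set \<Rightarrow> 'g letter list \<Rightarrow> 'g letter list \<Rightarrow> bool"
  for R where
  refl: "pres_eq R w w"
| sym: "pres_eq R u v \<Longrightarrow> pres_eq R v u"
| trans: "pres_eq R u v \<Longrightarrow> pres_eq R v w \<Longrightarrow> pres_eq R u w"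
| cancel: "pres_eq R (u @ [a, inv_letter a] @ w) (u @ w)"
| relator: "r \<in> R \<Longrightarrow> pres_eq R (u @ r @ w) (u @ w)"

definition word_length :: "'g letter list set \<Rightarrow> 'g set \<Rightarrow> 'g letter list \<Rightarrow> nat" where
  "word_length R A w = (LEAST k. \<exists>w'. word_over A w' \<and> pres_eq R w w' \<and> length w' = k)"

definition simple_graph :: "nat \<Rightarrow> (nat \<Rightarrow> nat \<Rightarrow> bool) \<Rightarrow> bool" where
  "simple_graph n E \<longleftrightarrow> (\<forall>s t. E s t \<longrightarrow> s < n \<and> t < n \<and> s \<noteq> t \<and> E t s)"

definition commutator :: "'g \<Rightarrow> 'g \<Rightarrow> 'g letter list" where
  "commutator s t = [(s, True), (t, True), (s, False), (t, False)]"

definition raag_rels :: "nat \<Rightarrow> (nat \<Rightarrow> nat \<Rightarrow> bool) \<Rightarrow> nat letter list set" where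
  "raag_rels n E = {commutator s t | s t. E s t}"

definition subst :: "('g \<Rightarrow> 'h letter list) \<Rightarrow> 'g letter list \<Rightarrow> 'h letter list" where
  "subst phi w = concat (map (\<lambda>a. if snd a then phi (fst a) else inv_word (phi (fst a))) w)"

definition raag_aut :: "nat \<Rightarrow> (nat \<Rightarrow> nat \<Rightarrow> bool) \<Rightarrow> (nat \<Rightarrow> nat letter list) \<Rightarrow> bool" where
  "raag_aut n E phi \<longleftrightarrow>
     (\<forall>x < n. word_over {..<n} (phi x)) \<and>
     (\<forall>u v. word_over {..<n} u \<longrightarrow> word_over {..<n} v \<longrightarrow>
        pres_eq (raag_rels n E) u v \<longrightarrow> pres_eq (raag_rels n E) (subst phi u) (subst phi v)) \<and>
     (\<forall>u v. word_over {..<n} u \<longrightarrow> word_over {..<n} v \<longrightarrow>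
        pres_eq (raag_rels n E) (subst phi u) (subst phi v) \<longrightarrow> pres_eq (raag_rels n E) u v) \<and>
     (\<forall>w. word_over {..<n} w \<longrightarrow>
        (\<exists>u. word_over {..<n} u \<and> pres_eq (raag_rels n E) (subst phi u) w))"

definition length_preserving :: "nat \<Rightarrow> (nat \<Rightarrow> nat \<Rightarrow> bool) \<Rightarrow> (nat \<Rightarrow> nat letter list) \<Rightarrow> bool" where
  "length_preserving n E phi \<longleftrightarrow>
     (\<forall>w. word_over {..<n} w \<longrightarrow>
        word_length (raag_rels n E) {..<n} (subst phi w) = word_length (raag_rels n E) {..<n} w)"

definition aut_power_id :: "nat \<Rightarrow> (nat \<Rightarrow> nat \<Rightarrow> bool) \<Rightarrow> (nat \<Rightarrow> nat letter list) \<Rightarrow> nat \<Rightarrow> bool" where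
  "aut_power_id n E phi k \<longleftrightarrow>
     (\<forall>x < n. pres_eq (raag_rels n E) ((subst phi ^^ k) [(x, True)]) [(x, True)])"

definition aut_order :: "nat \<Rightarrow> (nat \<Rightarrow> nat \<Rightarrow> bool) \<Rightarrow> (nat \<Rightarrow> nat letter list) \<Rightarrow> nat \<Rightarrow> bool" where
  "aut_order n E phi m \<longleftrightarrow> 0 < m \<and> aut_power_id n E phi m \<and>
     (\<forall>k. 0 < k \<and> k < m \<longrightarrow> \<not> aut_power_id n E phi k)"

text \<open>Generators: Some x for the vertex x, None for t.\<close>
definition lift_word :: "nat letter list \<Rightarrow> nat option letter list" where
  "lift_word w = map (\<lambda>a. (Some (fst a), snd a)) w"

definition semidirect_rels ::
  "nat \<Rightarrow> (nat \<Rightarrow> nat \<Rightarrow> bool) \<Rightarrow> (nat \<Rightarrow> nat letter list) \<Rightarrow> nat \<Rightarrow> nat option letter list set" where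
  "semidirect_rels n E phi m =
     {commutator (Some s) (Some s') | s s'. E s s'}
     \<union> {replicate m (None, True)}
     \<union> {[(None, False), (Some x, True), (None, True)] @ inv_word (lift_word (phi x)) | x. x < n}"

definition semidirect_gens :: "nat \<Rightarrow> nat option set" where
  "semidirect_gens n = insert None (Some ` {..<n})"

definition conjugate_words :: "'g letter list set \<Rightarrow> 'g set \<Rightarrow> 'g letter list \<Rightarrow> 'g letter list \<Rightarrow> bool" where
  "conjugate_words R A u v \<longleftrightarrow> (\<exists>w. word_over A w \<and> pres_eq R (w @ u @ inv_word w) v)"

datatype recf = Zero | Succ | Proj nat | Comp recf "recf list" | Prim recf recf | Mu recf

inductive eval_recf :: "recf \<Rightarrow> nat list \<Rightarrow> nat \<Rightarrow> bool" where
  zero: "eval_recf Zero xs 0"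
| succ: "eval_recf Succ (x # xs) (Suc x)"
| proj: "i < length xs \<Longrightarrow> eval_recf (Proj i) xs (xs ! i)"
| comp: "list_all2 (\<lambda>g y. eval_recf g xs y) gs ys \<Longrightarrow> eval_recf f ys z \<Longrightarrow> eval_recf (Comp f gs) xs z"
| prim0: "eval_recf f xs z \<Longrightarrow> eval_recf (Prim f g) (0 # xs) z"
| primS: "eval_recf (Prim f g) (k # xs) y \<Longrightarrow> eval_recf g (y # k # xs) z \<Longrightarrow>
          eval_recf (Prim f g) (Suc k # xs) z"
| mu: "eval_recf f (k # xs) 0 \<Longrightarrow> (\<forall>j < k. \<exists>y. eval_recf f (j # xs) y \<and> y \<noteq> 0) \<Longrightarrow>
       eval_recf (Mu f) xs k"

definition encode_letter :: "nat option letter \<Rightarrow> nat" where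
  "encode_letter a = prod_encode (case fst a of None \<Rightarrow> 0 | Some x \<Rightarrow> Suc x, if snd a then 1 else 0)"

definition encode_word :: "nat option letter list \<Rightarrow> nat" where
  "encode_word w = list_encode (map encode_letter w)"

definition conjugacy_problem_solvable ::
  "nat option letter list set \<Rightarrow> nat option set \<Rightarrow> bool" where
  "conjugacy_problem_solvable R A \<longleftrightarrow>
     (\<exists>f. \<forall>u v. word_over A u \<longrightarrow> word_over A v \<longrightarrow>
        eval_recf f [prod_encode (encode_word u, encode_word v)]
          (if conjugate_words R A u v then 1 else 0))"

end

theory Submission
  imports Defs
begin

text \<open>
  A length-preserving automorphism permutes the letters, so an element of the semidirect product is
  \<open>a t\<^sup>i\<close> with \<open>a\<close> in the right-angled Artin group, and conjugacy of \<open>a t\<^sup>i\<close> and \<open>b t\<^sup>j\<close> means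
  \<open>c a' = b \<tau>(c)\<close> for some \<open>c\<close>, where \<open>a'\<close> is an image of \<open>a\<close> under a power of the automorphism
  and \<open>\<tau>\<close> is another power. Let \<open>P\<^sub>k(c)\<close> be the product of the last \<open>k\<close> layers of the
  Foata normal form of the reduced word of \<open>c\<close>. Multiplying \<open>c\<close> by a letter on the left changes
  \<open>P\<^sub>k(c)\<close> by at most one letter, and multiplying it on the right changes \<open>P\<^sub>k(c)\<close>, up to that
  letter, by a clique of commuting letters. Hence the elements \<open>P\<^sub>k(c) a' \<tau>(P\<^sub>k(c))\<^sup>-\<^sup>1\<close> form a
  chain of twisted conjugates from \<open>a'\<close> to \<open>b\<close> of bounded length in which consecutive ones differ
  by conjugation by a clique. A chain without repetitions gives a conjugator of computably bounded
  length, which can be searched for using the solution of the word problem by reduced words.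
\<close>

section \<open>Words in presented groups\<close>

text \<open>A conjugator may be arbitrarily long, and \<open>c a' = b \<tau>(c)\<close> equates
  elements given by different words, so cutting a word for \<open>c\<close> after \<open>k\<close>
  letters gives pieces that cannot be compared across the equation. Layers depend only on the
  element, so \<open>P_k\<close> can be applied to both sides, and \<open>P_k\<close> commutes with
  \<open>\<tau>\<close> because \<open>\<tau>\<close> permutes the letters and respects which of
  them commute. Layers are counted from the right because \<open>a'\<close> stands to the right of
  \<open>c\<close>: a partial conjugation must use an end piece of \<open>c\<close>. In both groups
  uniqueness of normal forms comes from letting letters act on normal forms and checking that
  relators act trivially. In the Artin group these forms are unique only up to commutations, so the
  actions are studied modulo trace equivalence. Solvability asks for a recursive function. Hence the
  search bound is an arithmetic expression in the two input lengths, and normal forms are computed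
  by explicit recursion on words.\<close>

lemma inv_letter_inv [simp]: "inv_letter (inv_letter a) = a"
  by (simp add: inv_letter_def)

lemma fst_inv_letter [simp]: "fst (inv_letter a) = fst a"
  by (simp add: inv_letter_def)

lemma inv_letter_neq [simp]: "inv_letter a \<noteq> a" "a \<noteq> inv_letter a"
  by (auto simp: inv_letter_def prod_eq_iff)

lemma inv_word_simps [simp]:
  "inv_word [] = []" "inv_word (a # w) = inv_word w @ [inv_letter a]"
  "inv_word (u @ v) = inv_word v @ inv_word u" "inv_word (inv_word w) = w"
  "length (inv_word w) = length w"
  by (simp_all add: inv_word_def rev_map o_def)

lemma word_over_simps [simp]:
  "word_over A []" "word_over A (a # w) \<longleftrightarrow> fst a \<in> A \<and> word_over A w"
  "word_over A (u @ v) \<longleftrightarrow> word_over A u \<and> word_over A v"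
  "word_over A (inv_word w) \<longleftrightarrow> word_over A w"
  by (auto simp: word_over_def inv_word_def)

lemma word_over_subset: "set u \<subseteq> set v \<Longrightarrow> word_over A v \<Longrightarrow> word_over A u"
  by (auto simp: word_over_def)

declare pres_eq.trans [trans]

lemma pres_eq_context: "pres_eq R u v \<Longrightarrow> pres_eq R (x @ u @ y) (x @ v @ y)"
proof (induction rule: pres_eq.induct)
  case (cancel u a w)
  show ?case using pres_eq.cancel[of R "x @ u" a "w @ y"] by simp
next
  case (relator r u w)
  then show ?case using pres_eq.relator[of r R "x @ u" "w @ y"] by simp
qed (auto intro: pres_eq.intros)

lemma pres_eq_append: "pres_eq R u u' \<Longrightarrow> pres_eq R v v' \<Longrightarrow> pres_eq R (u @ v) (u' @ v')"
  using pres_eq_context[of R u u' "[]" v] pres_eq_context[of R v v' u' "[]"]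
  by (auto intro: pres_eq.trans)

lemma pres_eq_Cons: "pres_eq R v v' \<Longrightarrow> pres_eq R (a # v) (a # v')"
  using pres_eq_append[of R "[a]" "[a]" v v'] by (simp add: pres_eq.refl)

lemma pres_eq_inv_right: "pres_eq R (w @ inv_word w) []"
proof (induction w)
  case (Cons a w)
  have "pres_eq R ([a] @ (w @ inv_word w) @ [inv_letter a]) ([a] @ [] @ [inv_letter a])"
    by (rule pres_eq_context) (rule Cons)
  with pres_eq.cancel[of R "[]" a "[]"] show ?case by (auto intro: pres_eq.trans)
qed (simp add: pres_eq.refl)

lemma pres_eq_inv_left: "pres_eq R (inv_word w @ w) []"
  using pres_eq_inv_right[of R "inv_word w"] by simp

lemma pres_eq_cancel_left:
  assumes "pres_eq R (w @ u) (w @ v)" shows "pres_eq R u v"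
proof -
  have *: "pres_eq R (inv_word w @ w @ u) u" for u
    using pres_eq_append[OF pres_eq_inv_left pres_eq.refl] by fastforce
  have "pres_eq R (inv_word w @ w @ u) (inv_word w @ w @ v)"
    by (rule pres_eq_append[OF pres_eq.refl assms])
  then show ?thesis by (rule pres_eq.trans[OF pres_eq.sym[OF *] pres_eq.trans[OF _ *]])
qed

lemma pres_eq_cancel_right:
  assumes "pres_eq R (u @ w) (v @ w)" shows "pres_eq R u v"
proof -
  have *: "pres_eq R (u @ w @ inv_word w) u" for u
    using pres_eq_append[OF pres_eq.refl pres_eq_inv_right] by fastforce
  have "pres_eq R ((u @ w) @ inv_word w) ((v @ w) @ inv_word w)"
    by (rule pres_eq_append[OF assms pres_eq.refl])
  then have "pres_eq R (u @ w @ inv_word w) (v @ w @ inv_word w)" by simp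
  then show ?thesis by (rule pres_eq.trans[OF pres_eq.sym[OF *] pres_eq.trans[OF _ *]])
qed

lemma pres_eq_move_left:
  "pres_eq R (w @ u) v \<longleftrightarrow> pres_eq R u (inv_word w @ v)"
proof -
  have "pres_eq R (w @ inv_word w @ v) v"
    using pres_eq_append[OF pres_eq_inv_right pres_eq.refl] by fastforce
  then show ?thesis
    by (metis pres_eq.sym pres_eq.trans pres_eq_append pres_eq.refl pres_eq_cancel_left)
qed

lemma pres_eq_move_right:
  "pres_eq R (u @ w) v \<longleftrightarrow> pres_eq R u (v @ inv_word w)"
proof -
  have "pres_eq R ((v @ inv_word w) @ w) v"
    using pres_eq_append[OF pres_eq.refl pres_eq_inv_left] by fastforce
  then show ?thesis
    by (metis pres_eq.sym pres_eq.trans pres_eq_append pres_eq.refl pres_eq_cancel_right)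
qed

text \<open>Van der Waerden's method: an action in which inverse letters cancel and relators fix
  every state factors through the presented group. States are compared by \<open>eqv\<close> because
  normal forms are unique only up to commutations, and restricted to \<open>V\<close> because
  cancellation needs reduced words.\<close>

lemma pres_eq_action:
  assumes eqv: "\<And>s. eqv s s" "\<And>s t. eqv s t \<Longrightarrow> eqv t s" "\<And>s t r. eqv s t \<Longrightarrow> eqv t r \<Longrightarrow> eqv s r"
    and V: "\<And>a s. V s \<Longrightarrow> V (act a s)"
    and cong: "\<And>a s t. V s \<Longrightarrow> V t \<Longrightarrow> eqv s t \<Longrightarrow> eqv (act a s) (act a t)"
    and inv: "\<And>a s. V s \<Longrightarrow> eqv (act a (act (inv_letter a) s)) s"
    and rel: "\<And>r s. r \<in> R \<Longrightarrow> V s \<Longrightarrow> eqv (foldr act r s) s"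
    and "pres_eq R u v" "V s"
  shows "eqv (foldr act u s) (foldr act v s)"
proof -
  have V': "V (foldr act w s)" if "V s" for w s
    using that by (induction w) (auto intro: V)
  have cong': "eqv (foldr act w s) (foldr act w t)" if "V s" "V t" "eqv s t" for w s t
    using that by (induction w) (auto intro: V' cong)
  from \<open>pres_eq R u v\<close> \<open>V s\<close> show ?thesis
  proof (induction arbitrary: s rule: pres_eq.induct)
    case (cancel u a w)
    then show ?case by (simp, intro cong' V' V inv)
  next
    case (relator r u w)
    then show ?case using rel by (auto intro!: cong' V' V)
  qed (auto intro: eqv)
qed

section \<open>Traces and reduced words\<close>

locale trace_reduction =
  fixes ind :: "'a \<Rightarrow> 'a \<Rightarrow> bool" and iv :: "'a \<Rightarrow> 'a"
  assumes ind_sym: "ind a b \<Longrightarrow> ind b a"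
    and ind_irrefl [simp]: "\<not> ind a a"
    and ind_inv_left [simp]: "ind (iv a) b \<longleftrightarrow> ind a b"
    and inv_inv [simp]: "iv (iv a) = a"
    and inv_neq [simp]: "iv a \<noteq> a"
begin

lemma ind_inv_right [simp]: "ind a (iv b) \<longleftrightarrow> ind a b"
  using ind_sym[of a] ind_sym[of _ a] ind_inv_left by blast

lemma inv_eq_iff [simp]: "iv a = iv b \<longleftrightarrow> a = b"
  by (metis inv_inv)

text \<open>Two words represent the same trace iff their projections to all pairs of dependent letters
  agree. Taking this as the definition makes cancellativity immediate.\<close>

definition teq :: "'a list \<Rightarrow> 'a list \<Rightarrow> bool" (infix "\<sim>" 50) where
  "u \<sim> v \<longleftrightarrow> (\<forall>a b. \<not> ind a b \<longrightarrow> filter (\<lambda>c. c = a \<or> c = b) u = filter (\<lambda>c. c = a \<or> c = b) v)"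

lemma teq_refl [simp]: "u \<sim> u"
  by (simp add: teq_def)

lemma teq_sym: "u \<sim> v \<Longrightarrow> v \<sim> u"
  by (simp add: teq_def)

lemma teq_trans [trans]: "u \<sim> v \<Longrightarrow> v \<sim> w \<Longrightarrow> u \<sim> w"
  by (simp add: teq_def)

lemma teq_append_cancel [simp]: "w @ u \<sim> w @ v \<longleftrightarrow> u \<sim> v"
  by (simp add: teq_def)

lemma teq_Cons_cancel [simp]: "a # u \<sim> a # v \<longleftrightarrow> u \<sim> v"
  using teq_append_cancel[of "[a]" u v] by simp

lemma teq_rev: "rev u \<sim> rev v \<longleftrightarrow> u \<sim> v"
  by (simp add: teq_def rev_filter[symmetric])

lemma teq_move:
  assumes "\<And>z. z \<in> set p \<Longrightarrow> ind a z" shows "p @ a # q \<sim> a # p @ q"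
  unfolding teq_def
proof (intro allI impI)
  fix c d assume cd: "\<not> ind c d"
  show "filter (\<lambda>z. z = c \<or> z = d) (p @ a # q) = filter (\<lambda>z. z = c \<or> z = d) (a # p @ q)"
  proof (cases "a = c \<or> a = d")
    case True
    have "\<not> (z = c \<or> z = d)" if "z \<in> set p" for z
      using assms[OF that] ind_sym[OF assms[OF that]] True cd by auto
    then have "filter (\<lambda>z. z = c \<or> z = d) p = []" by (simp add: filter_empty_conv)
    then show ?thesis by simp
  qed auto
qed

lemma teq_swap: "ind a b \<Longrightarrow> a # b # w \<sim> b # a # w"
  using teq_move[of "[b]" a w] by (simp add: teq_sym)

text \<open>Projection to \<open>a\<close> alone shows that \<open>a\<close> occurs in
  \<open>w2\<close>. A dependent letter before its first occurrence would make the projection to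
  that pair begin with a letter other than \<open>a\<close>.\<close>

lemma teq_Cons_split:
  assumes "a # w \<sim> w2"
  obtains p q where "w2 = p @ a # q" "\<And>z. z \<in> set p \<Longrightarrow> ind a z" "w \<sim> p @ q"
proof -
  have "filter (\<lambda>c. c = a \<or> c = a) (a # w) = filter (\<lambda>c. c = a \<or> c = a) w2"
    by (rule assms[unfolded teq_def, rule_format, OF ind_irrefl])
  then have "a # filter (\<lambda>c. c = a) w = filter (\<lambda>c. c = a) w2" by simp
  then have "a \<in> set (filter (\<lambda>c. c = a) w2)" by (metis list.set_intros(1))
  then have "a \<in> set w2" by simp
  then obtain p q where w2: "w2 = p @ a # q" "a \<notin> set p" by (meson split_list_first)
  have p: "ind a z" if z: "z \<in> set p" for z
  proof (rule ccontr)
    assume "\<not> ind a z"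
    then have *: "a # filter (\<lambda>c. c = a \<or> c = z) w = filter (\<lambda>c. c = a \<or> c = z) p @ filter (\<lambda>c. c = a \<or> c = z) (a # q)"
      using assms[unfolded teq_def, rule_format, OF \<open>\<not> ind a z\<close>] by (simp add: w2)
    have "filter (\<lambda>c. c = a \<or> c = z) p \<noteq> []" using z by (auto simp: filter_empty_conv)
    then obtain c r where r: "filter (\<lambda>c. c = a \<or> c = z) p = c # r" by (meson neq_Nil_conv)
    then have "c \<in> set p" by (metis filter_is_subset list.set_intros(1) subsetD)
    moreover have "c = a" using * r by simp
    ultimately show False using w2 by simp
  qed
  have "a # w \<sim> a # p @ q" using assms teq_move[of p a q] p w2 teq_trans by blast
  then show ?thesis using that w2 p by simp
qed

definition swap_step :: "'a list \<Rightarrow> 'a list \<Rightarrow> bool" where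
  "swap_step u v \<longleftrightarrow> (\<exists>x a b y. u = x @ a # b # y \<and> v = x @ b # a # y \<and> ind a b)"

lemma swap_steps_Cons: "swap_step\<^sup>*\<^sup>* u v \<Longrightarrow> swap_step\<^sup>*\<^sup>* (a # u) (a # v)"
proof (induction rule: rtranclp_induct)
  case (step v w)
  then obtain x b c y where "v = x @ b # c # y" "w = x @ c # b # y" "ind b c"
    unfolding swap_step_def by blast
  then have "a # v = (a # x) @ b # c # y \<and> a # w = (a # x) @ c # b # y \<and> ind b c" by simp
  then have "swap_step (a # v) (a # w)" unfolding swap_step_def by blast
  with step show ?case by simp
qed simp

lemma swap_steps_move: "(\<And>z. z \<in> set p \<Longrightarrow> ind a z) \<Longrightarrow> swap_step\<^sup>*\<^sup>* (a # p @ q) (p @ a # q)"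
proof (induction p)
  case (Cons b p)
  then have "a # b # p @ q = [] @ a # b # p @ q \<and> b # a # p @ q = [] @ b # a # p @ q \<and> ind a b"
    by simp
  then have "swap_step (a # b # p @ q) (b # a # p @ q)" unfolding swap_step_def by blast
  moreover have "swap_step\<^sup>*\<^sup>* (b # a # p @ q) (b # p @ a # q)"
    using Cons by (intro swap_steps_Cons) auto
  ultimately show ?case by simp
qed simp

text \<open>Connects the projection criterion with the usual definition of traces: the first letter
  of \<open>u\<close> is moved to its place in \<open>v\<close> by swaps and the rest follows by
  induction. Invariants then need checking for a single swap only.\<close>

lemma teq_swap_steps: "u \<sim> v \<Longrightarrow> swap_step\<^sup>*\<^sup>* u v"
proof (induction u arbitrary: v)
  case Nil
  have "v = []"
  proof (rule ccontr)
    assume "v \<noteq> []"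
    then obtain a w where "v = a # w" by (meson neq_Nil_conv)
    then have "a # w \<sim> []" using Nil teq_sym by simp
    then show False by (elim teq_Cons_split) simp
  qed
  then show ?case by simp
next
  case (Cons a u)
  from Cons.prems obtain p q where v: "v = p @ a # q" "\<And>z. z \<in> set p \<Longrightarrow> ind a z" "u \<sim> p @ q"
    by (elim teq_Cons_split) blast
  then have "swap_step\<^sup>*\<^sup>* (a # u) (a # p @ q)" using Cons.IH swap_steps_Cons by blast
  also have "swap_step\<^sup>*\<^sup>* (a # p @ q) v" using v swap_steps_move by blast
  finally show ?case .
qed

lemma teq_invariant:
  assumes "u \<sim> v" "\<And>x a b y. ind a b \<Longrightarrow> f (x @ a # b # y) = f (x @ b # a # y)"
  shows "f u = f v"
  using teq_swap_steps[OF assms(1)]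
proof (induction rule: rtranclp_induct)
  case (step v w)
  then obtain x a b y where "v = x @ a # b # y" "w = x @ b # a # y" "ind a b"
    unfolding swap_step_def by blast
  then show ?case using step.IH assms(2)[of a b x y] by simp
qed simp

lemma teq_length: "u \<sim> v \<Longrightarrow> length u = length v"
  by (rule teq_invariant) auto

lemma teq_set: "u \<sim> v \<Longrightarrow> set u = set v"
  by (rule teq_invariant) auto

section \<open>Reduced words and left multiplication by letters\<close>

definition reduced :: "'a list \<Rightarrow> bool" where
  "reduced w \<longleftrightarrow> (\<nexists>p y q. w \<sim> p @ y # iv y # q)"

lemma reduced_teq: "u \<sim> v \<Longrightarrow> reduced u \<Longrightarrow> reduced v"
  unfolding reduced_def by (meson teq_trans)

lemma reduced_Nil [simp]: "reduced []"
  unfolding reduced_def by (auto dest!: teq_length)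

lemma reduced_single [simp]: "reduced [a]"
  unfolding reduced_def by (auto dest!: teq_length)

lemma reduced_ConsD: "reduced (a # w) \<Longrightarrow> reduced w"
  unfolding reduced_def by (metis append_Cons teq_Cons_cancel)

lemma reduced_rev: assumes "reduced w" shows "reduced (rev w)"
  unfolding reduced_def
proof safe
  fix p y q assume "rev w \<sim> p @ y # iv y # q"
  then have "w \<sim> rev q @ iv y # iv (iv y) # rev p"
    using teq_rev[of "rev w" "p @ y # iv y # q"] by simp
  with assms show False unfolding reduced_def by blast
qed

text \<open>Locate \<open>y\<close> relative to a cancelling pair. Outside the pair, it leaves the
  pair intact in \<open>w\<close>; as first member, it leaves an \<open>iv y\<close> that can be
  moved to the front of \<open>w\<close>; as second member, it would have to commute past its own
  inverse.\<close>

lemma reduced_ConsI: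
  assumes "reduced w" and no: "\<And>w'. w \<sim> iv y # w' \<Longrightarrow> False"
  shows "reduced (y # w)"
  unfolding reduced_def
proof safe
  fix p z q assume "y # w \<sim> p @ z # iv z # q"
  then obtain p' q' where eq: "p @ z # iv z # q = p' @ y # q'"
    and p': "\<And>x. x \<in> set p' \<Longrightarrow> ind y x" and w: "w \<sim> p' @ q'"
    by (elim teq_Cons_split) blast
  consider us where "p = p' @ us" "us @ z # iv z # q = y # q'"
    | us where "p' = p @ us" "z # iv z # q = us @ y # q'"
    using eq unfolding append_eq_append_conv2 by metis
  then consider us where "p = p' @ y # us" "q' = us @ z # iv z # q"
    | "p' = p" "y = z" "q' = iv z # q"
    | "p' = p @ [z]" "y = iv z"
    | us where "p' = p @ z # iv z # us" "q = us @ y # q'"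
  proof cases
    case (1 us)
    then show ?thesis using that(1,2) by (cases us) auto
  next
    case (2 us)
    then consider "us = []" | "us = [z]" "y = iv z" | v where "us = z # iv z # v" "q = v @ y # q'"
      by (auto simp: Cons_eq_append_conv)
    then show ?thesis using that(2-4) 2 by cases auto
  qed
  then show False
  proof cases
    case 1
    then have "w \<sim> (p' @ us) @ z # iv z # q" using w by simp
    then show False using \<open>reduced w\<close> unfolding reduced_def by blast
  next
    case 2
    then have "w \<sim> p @ iv y # q" using w by simp
    also have "\<dots> \<sim> iv y # p @ q" using 2 p' by (intro teq_move) simp
    finally have "w \<sim> iv y # p @ q" .
    then show False using no by blast
  next
    case 3
    then show False using p'[of z] by simp
  next
    case 4
    then have "w \<sim> p @ z # iv z # us @ q'" using w by simp
    then show False using \<open>reduced w\<close> unfolding reduced_def by blast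
  qed
qed

text \<open>An executable substitute for choosing a representative of the trace that starts with
  \<open>y\<close>; it keeps \<open>lmul\<close> computable.\<close>

fun remove_first :: "'a \<Rightarrow> 'a list \<Rightarrow> 'a list option" where
  "remove_first y [] = None"
| "remove_first y (z # w) = (if z = y then Some w
     else if ind y z then map_option (Cons z) (remove_first y w) else None)"

lemma remove_first_Some: "remove_first y w = Some w' \<Longrightarrow> w \<sim> y # w'"
proof (induction w arbitrary: w')
  case (Cons z w)
  show ?case
  proof (cases "z = y")
    case False
    with Cons.prems obtain v where v: "ind y z" "remove_first y w = Some v" "w' = z # v"
      by (auto split: if_splits)
    then have "z # w \<sim> z # y # v" using Cons.IH by simp
    also have "\<dots> \<sim> y # z # v" by (rule teq_swap[OF ind_sym[OF v(1)]])
    finally show ?thesis using v by simp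
  qed (use Cons.prems in simp)
qed simp

lemma remove_first_exists:
  assumes "w \<sim> y # w'" shows "remove_first y w \<noteq> None"
proof -
  have "y # w' \<sim> w" using assms by (rule teq_sym)
  then obtain p q where w: "w = p @ y # q" "\<And>z. z \<in> set p \<Longrightarrow> ind y z"
    by (elim teq_Cons_split) blast
  have "remove_first y (p @ y # q) \<noteq> None"
    using w(2) by (induction p) auto
  then show ?thesis using w(1) by simp
qed

definition lmul :: "'a \<Rightarrow> 'a list \<Rightarrow> 'a list" where
  "lmul y w = (case remove_first (iv y) w of None \<Rightarrow> y # w | Some w' \<Rightarrow> w')"

lemma lmul_cancel: assumes "w \<sim> iv y # w'" shows "lmul y w \<sim> w'"
proof -
  obtain v where v: "remove_first (iv y) w = Some v"
    using remove_first_exists[OF assms] by blast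
  have "iv y # v \<sim> iv y # w'"
    using teq_trans[OF teq_sym[OF remove_first_Some[OF v]] assms] .
  then show ?thesis by (simp add: lmul_def v)
qed

lemma lmul_Cons: assumes "\<And>w'. w \<sim> iv y # w' \<Longrightarrow> False" shows "lmul y w = y # w"
  using assms remove_first_Some unfolding lmul_def
  by (cases "remove_first (iv y) w") (simp, blast)

lemma lmul_cases:
  obtains (cancel) w' where "w \<sim> iv y # w'" "lmul y w \<sim> w'"
    | (cons) "\<And>w'. w \<sim> iv y # w' \<Longrightarrow> False" "lmul y w = y # w"
  using lmul_cancel lmul_Cons by metis

lemma reduced_lmul: "reduced w \<Longrightarrow> reduced (lmul y w)"
proof (cases rule: lmul_cases[where y = y and w = w])
  case (cancel w')
  assume "reduced w"
  then have "reduced (iv y # w')" using reduced_teq cancel(1) by blast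
  then show ?thesis using reduced_teq[OF teq_sym[OF cancel(2)]] reduced_ConsD by blast
next
  case cons
  assume "reduced w"
  then have "reduced (y # w)" using cons(1) by (rule reduced_ConsI)
  then show ?thesis using cons(2) by simp
qed

lemma lmul_teq: assumes "u \<sim> v" shows "lmul y u \<sim> lmul y v"
proof (cases rule: lmul_cases[where y = y and w = u])
  case (cancel w')
  have "lmul y v \<sim> w'" by (rule lmul_cancel[OF teq_trans[OF teq_sym[OF assms] cancel(1)]])
  then show ?thesis by (rule teq_trans[OF cancel(2) teq_sym])
next
  case cons
  have "lmul y v = y # v" using cons(1) teq_trans[OF assms] by (intro lmul_Cons) blast
  then show ?thesis using cons(2) assms by simp
qed

text \<open>If \<open>iv y\<close> cancels a \<open>y\<close> of \<open>w\<close>, then prepending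
  \<open>y\<close> must not cancel a second time: a remainder starting with \<open>iv y\<close>
  would contradict that \<open>w\<close> is reduced.\<close>

lemma lmul_inverse: assumes "reduced w" shows "lmul y (lmul (iv y) w) \<sim> w"
proof (cases rule: lmul_cases[where y = "iv y" and w = w])
  case (cancel w')
  have "lmul y w' = y # w'"
  proof (rule lmul_Cons)
    fix w'' assume "w' \<sim> iv y # w''"
    then have "y # w' \<sim> y # iv y # w''" by simp
    then have "w \<sim> [] @ y # iv y # w''" using teq_trans[OF cancel(1)] by simp
    then show False using assms unfolding reduced_def by blast
  qed
  then have "lmul y (lmul (iv y) w) \<sim> y # w'" using lmul_teq[OF cancel(2)] by metis
  also have "y # w' \<sim> w" using teq_sym[OF cancel(1)] by simp
  finally show ?thesis .
next
  case cons
  then show ?thesis using lmul_cancel[of "iv y # w" y w] by simp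
qed

text \<open>Diamond property of traces: as \<open>a\<close> and \<open>b\<close> differ,
  \<open>b\<close> stands before the \<open>a\<close> that can be moved to the front, so it is among
  the letters that \<open>a\<close> passes.\<close>

lemma first_letters:
  assumes "a # u \<sim> b # v" "a \<noteq> b"
  obtains w where "u \<sim> b # w" "v \<sim> a # w" "ind a b"
proof -
  obtain p q where eq: "b # v = p @ a # q" and p: "\<And>z. z \<in> set p \<Longrightarrow> ind a z" and u: "u \<sim> p @ q"
    using assms(1) by (elim teq_Cons_split) blast
  then obtain p' where p': "p = b # p'" "v = p' @ a # q"
    using assms(2) by (auto simp: Cons_eq_append_conv)
  then have "v \<sim> a # p' @ q" using p by (auto intro: teq_move)
  then show ?thesis using that[of "p' @ q"] u p p' by simp
qed

lemma lmul_comm_cancel: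
  assumes ab: "ind a b" and w: "w \<sim> iv a # w1"
  shows "lmul a (lmul b w) \<sim> lmul b (lmul a w)"
proof -
  have a: "lmul b (lmul a w) \<sim> lmul b w1" by (intro lmul_teq lmul_cancel w)
  have neq: "iv a \<noteq> iv b" using ab by auto
  show ?thesis
  proof (cases rule: lmul_cases[where y = b and w = w])
    case (cancel w2)
    have "iv a # w1 \<sim> iv b # w2" by (rule teq_trans[OF teq_sym[OF w] cancel(1)])
    then obtain v where "w1 \<sim> iv b # v" "w2 \<sim> iv a # v"
      using neq by (elim first_letters) blast
    then have "lmul b w1 \<sim> v" "lmul a w2 \<sim> v" by (auto intro: lmul_cancel)
    then have "lmul a (lmul b w) \<sim> v" "lmul b (lmul a w) \<sim> v"
      using teq_trans[OF lmul_teq[OF cancel(2), of a]] teq_trans[OF a] by simp_all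
    then show ?thesis by (rule teq_trans[OF _ teq_sym])
  next
    case cons
    have "lmul b w1 = b # w1"
    proof (rule lmul_Cons)
      fix w3 assume "w1 \<sim> iv b # w3"
      then have "w \<sim> iv a # iv b # w3" using teq_trans[OF w] by simp
      also have "\<dots> \<sim> iv b # iv a # w3" using ab by (intro teq_swap) simp
      finally show False using cons by blast
    qed
    have "b # w \<sim> b # iv a # w1" using w by simp
    also have "\<dots> \<sim> iv a # b # w1" using ind_sym[OF ab] by (intro teq_swap) simp
    finally have "lmul a (lmul b w) \<sim> b # w1" using cons by (auto intro: lmul_cancel)
    then show ?thesis using teq_trans[OF _ teq_sym[OF a]] \<open>lmul b w1 = b # w1\<close> by simp
  qed
qed

text \<open>The identity behind the trivial action of commutators. If one letter cancels, the
  diamond property settles the rest; if neither does, both are merely prepended and can be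
  swapped.\<close>

lemma lmul_comm:
  assumes ab: "ind a b"
  shows "lmul a (lmul b w) \<sim> lmul b (lmul a w)"
proof (cases "(\<exists>w'. w \<sim> iv a # w') \<or> (\<exists>w'. w \<sim> iv b # w')")
  case True
  then show ?thesis
    using lmul_comm_cancel[OF ab] teq_sym[OF lmul_comm_cancel[OF ind_sym[OF ab]]] by blast
next
  case False
  have *: "lmul a (b # w) = a # b # w" if "ind a b" "\<And>w'. w \<sim> iv a # w' \<Longrightarrow> False" for a b
  proof (rule lmul_Cons)
    fix w' assume "b # w \<sim> iv a # w'"
    moreover have "b \<noteq> iv a" using that(1) by auto
    ultimately show False using that(2) by (elim first_letters) auto
  qed
  have no: "w \<sim> iv a # w' \<Longrightarrow> False" "w \<sim> iv b # w' \<Longrightarrow> False" for w'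
    using False by blast+
  have "lmul a (lmul b w) = a # b # w" "lmul b (lmul a w) = b # a # w"
    using *[OF ab no(1)] *[OF ind_sym[OF ab] no(2)] lmul_Cons[OF no(1)] lmul_Cons[OF no(2)] by simp_all
  then show ?thesis using ab teq_swap by simp
qed

definition red :: "'a list \<Rightarrow> 'a list" where
  "red w = foldr lmul w []"

lemma reduced_foldr_lmul: "reduced s \<Longrightarrow> reduced (foldr lmul w s)"
  by (induction w) (auto intro: reduced_lmul)

lemma reduced_red: "reduced (red w)"
  by (simp add: red_def reduced_foldr_lmul)

lemma red_reduced: "reduced w \<Longrightarrow> red w = w"
proof (induction w)
  case (Cons a w)
  have "lmul a w = a # w"
  proof (rule lmul_Cons)
    fix w' assume "w \<sim> iv a # w'"
    then have "a # w \<sim> [] @ a # iv a # w'" by simp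
    with Cons.prems show False unfolding reduced_def by blast
  qed
  then show ?case using Cons reduced_ConsD[of a w] by (simp add: red_def)
qed (simp add: red_def)

lemma set_remove_first: "remove_first y w = Some w' \<Longrightarrow> set w' \<subseteq> set w"
  by (induction w arbitrary: w') (fastforce split: if_splits)+

lemma set_lmul: "set (lmul y w) \<subseteq> insert y (set w)"
  by (auto simp: lmul_def split: option.splits dest: set_remove_first)

lemma set_foldr_lmul: "set (foldr lmul u s) \<subseteq> set u \<union> set s"
proof (induction u)
  case (Cons a u)
  then show ?case using set_lmul[of a "foldr lmul u s"] by auto
qed simp

lemma set_red: "set (red w) \<subseteq> set w"
  using set_foldr_lmul[of w "[]"] by (simp add: red_def)

lemma length_remove_first: "remove_first y w = Some w' \<Longrightarrow> length w' \<le> length w"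
  by (induction w arbitrary: w') (fastforce split: if_splits)+

text \<open>Mirror image of \<open>reduced_ConsI\<close>, since reversal preserves both trace
  equivalence and reducedness.\<close>

lemma reduced_snoc_cases:
  assumes "reduced w"
  obtains "reduced (w @ [y])" | w' where "w \<sim> w' @ [iv y]"
proof (cases "reduced (w @ [y])")
  case False
  then have "\<not> reduced (y # rev w)" using reduced_rev[of "y # rev w"] by auto
  then obtain v where "rev w \<sim> iv y # v"
    using reduced_ConsI[OF reduced_rev[OF assms]] by blast
  then have "rev (rev w) \<sim> rev (iv y # v)" by (subst teq_rev)
  then show ?thesis using that(2)[of "rev v"] by simp
qed (use that in blast)

subsection \<open>Layers of a trace\<close>

text \<open>The level of a letter prepended to \<open>w\<close> is the length of the longest chain of dependent
  letters below it; \<open>low k w\<close> consists of the letters of level less than \<open>k\<close>, i.e. of the last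
  \<open>k\<close> layers of the Foata normal form built from the right.\<close>

fun level :: "'a list \<Rightarrow> 'a \<Rightarrow> nat" where
  "level [] a = 0"
| "level (b # w) a = (if ind a b then level w a else max (level w a) (Suc (level w b)))"

fun low :: "nat \<Rightarrow> 'a list \<Rightarrow> 'a list" where
  "low k [] = []"
| "low k (b # w) = (if level w b < k then b # low k w else low k w)"

lemma level_swap: "ind a b \<Longrightarrow> level (x @ a # b # y) c = level (x @ b # a # y) c"
proof (induction x arbitrary: c)
  case Nil
  then show ?case using ind_sym[OF Nil] by (auto simp: max_def)
qed auto

lemma low_swap:
  assumes "ind a b" shows "low k (x @ a # b # y) \<sim> low k (x @ b # a # y)"
proof (induction x)
  case Nil
  then show ?case using assms ind_sym[OF assms] by (auto intro: teq_swap)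
qed (use level_swap[OF assms] in auto)

lemma low_teq: "u \<sim> v \<Longrightarrow> low k u \<sim> low k v"
proof -
  assume "u \<sim> v"
  from teq_swap_steps[OF this] show ?thesis
  proof (induction rule: rtranclp_induct)
    case (step v w)
    then have "low k v \<sim> low k w" unfolding swap_step_def using low_swap by blast
    with step.IH show ?case by (rule teq_trans)
  qed simp
qed

lemma set_low: "set (low k w) \<subseteq> set w"
  by (induction w) auto

lemma low_0 [simp]: "low 0 w = []"
  by (induction w) auto

lemma level_le: "level w a \<le> length w"
proof (induction w arbitrary: a)
  case (Cons b w)
  show ?case using Cons[of a] Cons[of b] by (auto simp: max_def)
qed simp

lemma low_eq: "length w \<le> k \<Longrightarrow> low k w = w"
proof (induction w)
  case (Cons b w)
  then show ?case using level_le[of w b] by auto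
qed simp

fun clique :: "'a list \<Rightarrow> bool" where
  "clique [] \<longleftrightarrow> True"
| "clique (a # D) \<longleftrightarrow> (\<forall>b \<in> set D. ind a b) \<and> clique D"

text \<open>\<open>D\<close> is the layer of level \<open>k\<close>. The induction also carries that
  any letter dependent on one in \<open>D\<close> has level above \<open>k\<close>; hence a new
  letter of level at most \<open>k\<close> commutes with all of \<open>D\<close>, and it can slide
  past \<open>D\<close> or join it.\<close>

lemma low_Suc:
  obtains D where "low (Suc k) w \<sim> D @ low k w" "clique D" "set D \<subseteq> set w"
proof -
  have "\<exists>D. low (Suc k) w \<sim> D @ low k w \<and> clique D \<and> set D \<subseteq> set w
      \<and> (\<forall>z \<in> set D. \<forall>a. \<not> ind a z \<longrightarrow> k < level w a)"
  proof (induction w)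
    case (Cons b w)
    then obtain D where D: "low (Suc k) w \<sim> D @ low k w" "clique D" "set D \<subseteq> set w"
      "\<And>z a. z \<in> set D \<Longrightarrow> \<not> ind a z \<Longrightarrow> k < level w a" by blast
    consider "level w b < k" | "level w b = k" | "level w b > k" by linarith
    then show ?case
    proof cases
      case 1
      then have "ind b z" if "z \<in> set D" for z using D(4)[OF that] by force
      then have "D @ b # low k w \<sim> b # D @ low k w" by (rule teq_move)
      moreover have "b # low (Suc k) w \<sim> b # D @ low k w" using D(1) by simp
      ultimately have "b # low (Suc k) w \<sim> D @ b # low k w" by (rule teq_trans[OF _ teq_sym, rotated])
      then have "low (Suc k) (b # w) \<sim> D @ low k (b # w)" using 1 by simp
      then show ?thesis using D by (intro exI[of _ D]) (fastforce simp: max_def)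
    next
      case 2
      then have "ind b z" if "z \<in> set D" for z using D(4)[OF that] by force
      then have "clique (b # D)" using D(2) by simp
      moreover have "low (Suc k) (b # w) \<sim> (b # D) @ low k (b # w)" using 2 D(1) by simp
      moreover have "k < level (b # w) a" if "z \<in> set (b # D)" "\<not> ind a z" for a z
        using that 2 D(4)[of z a] by (auto simp: max_def)
      ultimately show ?thesis using D(3) by (intro exI[of _ "b # D"]) auto
    next
      case 3
      then show ?thesis using D by (intro exI[of _ D]) (fastforce simp: max_def)
    qed
  qed simp
  then show ?thesis using that by blast
qed

text \<open>A chain of dependent letters can gain at most the letter \<open>y\<close> at its
  end.\<close>

lemma level_snoc: "level w a \<le> level (w @ [y]) a \<and> level (w @ [y]) a \<le> Suc (level w a)"
proof (induction w arbitrary: a)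
  case (Cons b w)
  show ?case using Cons[of a] Cons[of b] by (auto simp: max_def)
qed simp

text \<open>Appending \<open>y\<close> raises levels by at most one, so the letters lost from
  \<open>low k\<close> are those that move up to level exactly \<open>k\<close>. They commute by the
  same invariant as in \<open>low_Suc\<close>.\<close>

lemma low_snoc:
  obtains D where "low k w @ [y] \<sim> D @ low k (w @ [y])" "clique D" "set D \<subseteq> set (w @ [y])"
proof -
  have "\<exists>D. low k w @ [y] \<sim> D @ low k (w @ [y]) \<and> clique D \<and> set D \<subseteq> set (w @ [y])
      \<and> (\<forall>z \<in> set D. \<forall>a. \<not> ind a z \<longrightarrow> k < level (w @ [y]) a)"
  proof (induction w)
    case Nil
    \<comment> \<open>For \<open>k = 0\<close> the letter \<open>y\<close> itself is lost and forms
      \<open>D\<close>; for larger \<open>k\<close> it stays in the lowest layer and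
      \<open>D\<close> is empty.\<close>
    show ?case by (cases k) (auto intro: exI[of _ "[y]"] exI[of _ "[]"])
  next
    case (Cons b w)
    then obtain D where D: "low k w @ [y] \<sim> D @ low k (w @ [y])" "clique D" "set D \<subseteq> set (w @ [y])"
      "\<And>z a. z \<in> set D \<Longrightarrow> \<not> ind a z \<Longrightarrow> k < level (w @ [y]) a" by blast
    have lv: "level w b \<le> level (w @ [y]) b" "level (w @ [y]) b \<le> Suc (level w b)"
      using level_snoc[of w b y] by auto
    have D4: "k < level ((b # w) @ [y]) a" if "z \<in> set D" "\<not> ind a z" for a z
      using D(4)[OF that] by (auto simp: max_def)
    consider "level (w @ [y]) b < k" | "level w b < k" "level (w @ [y]) b = k" | "level w b \<ge> k"
      using lv by linarith
    then show ?case
    proof cases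
      case 1
      then have "ind b z" if "z \<in> set D" for z using D(4)[OF that] by force
      then have "D @ b # low k (w @ [y]) \<sim> b # D @ low k (w @ [y])" by (rule teq_move)
      moreover have "b # low k w @ [y] \<sim> b # D @ low k (w @ [y])" using D(1) by simp
      ultimately have "b # low k w @ [y] \<sim> D @ b # low k (w @ [y])"
        by (rule teq_trans[OF _ teq_sym, rotated])
      then have "low k (b # w) @ [y] \<sim> D @ low k ((b # w) @ [y])" using 1 lv by simp
      then show ?thesis using D(2,3) D4 by (intro exI[of _ D]) auto
    next
      case 2
      then have "ind b z" if "z \<in> set D" for z using D(4)[OF that] by force
      then have "clique (b # D)" using D(2) by simp
      moreover have "low k (b # w) @ [y] \<sim> (b # D) @ low k ((b # w) @ [y])" using 2 D(1) by simp
      moreover have "k < level ((b # w) @ [y]) a" if "z \<in> set (b # D)" "\<not> ind a z" for a z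
        using that 2 D4[of z a] by (auto simp: max_def)
      ultimately show ?thesis using D(3) by (intro exI[of _ "b # D"]) auto
    next
      case 3
      then have "low k (b # w) @ [y] \<sim> D @ low k ((b # w) @ [y])" using lv D(1) by simp
      then show ?thesis using D(2,3) D4 by (intro exI[of _ D]) auto
    qed
  qed
  then show ?thesis using that by blast
qed

text \<open>Levels are computed from independence alone, which \<open>f\<close> preserves. This lets
  the twist pass through the layers.\<close>

lemma low_map:
  assumes "\<And>a b. ind (f a) (f b) \<longleftrightarrow> ind a b" shows "low k (map f w) = map f (low k w)"
proof -
  have "level (map f w) (f a) = level w a" for a w
    by (induction w arbitrary: a) (auto simp: assms)
  then show ?thesis by (induction w) auto
qed

end

section \<open>Bounding twisted conjugators\<close>

text \<open>All intermediate conjugates have length at most \<open>n * p + q\<close>, there are at most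
  \<open>(2 * n + 1) ^ (n * p + q)\<close> words of that length, and a minimal chain uses each pair of them at
  most once, with a conjugator of length at most \<open>n\<close>.\<close>

definition conj_bound :: "nat \<Rightarrow> nat \<Rightarrow> nat \<Rightarrow> nat" where
  "conj_bound n p q = n * ((2 * n + 1) ^ (n * p + q)) ^ 2"

lemma conj_bound_mono: "p \<le> p' \<Longrightarrow> q \<le> q' \<Longrightarrow> conj_bound n p q \<le> conj_bound n p' q'"
  unfolding conj_bound_def by (intro mult_le_mono power_mono power_increasing add_mono) simp_all

section \<open>Words of the right-angled Artin group as traces\<close>

locale raag =
  fixes n :: nat and E :: "nat \<Rightarrow> nat \<Rightarrow> bool"
  assumes graph: "simple_graph n E"
begin

abbreviation "R \<equiv> raag_rels n E"

abbreviation eqA :: "nat letter list \<Rightarrow> nat letter list \<Rightarrow> bool" (infix "\<simeq>" 50) where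
  "u \<simeq> v \<equiv> pres_eq R u v"

definition ind :: "nat letter \<Rightarrow> nat letter \<Rightarrow> bool" where
  "ind a b \<longleftrightarrow> E (fst a) (fst b)"

sublocale trace_reduction ind inv_letter
  using graph by unfold_locales (auto simp: ind_def simple_graph_def)

notation teq (infix "\<sim>" 50)

lemma ind_fst_neq: "ind a b \<Longrightarrow> fst a \<noteq> fst b"
  using graph by (auto simp: ind_def simple_graph_def)

lemma comm_pos: assumes "E s t" shows "[(s, True), (t, True)] \<simeq> [(t, True), (s, True)]"
proof -
  have "commutator s t \<in> R" using assms by (auto simp: raag_rels_def)
  then have "[(s, True), (t, True)] @ inv_word [(t, True), (s, True)] \<simeq> []"
    using pres_eq.relator[of "commutator s t" R "[]" "[]"] by (simp add: commutator_def inv_letter_def)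
  then show ?thesis by (subst (asm) pres_eq_move_right) simp
qed

lemma comm_inv_letter: assumes "pres_eq S [a, b] [b, a]" shows "pres_eq S [inv_letter a, b] [b, inv_letter a]"
proof -
  have "pres_eq S ([a, b] @ [inv_letter a]) ([b, a] @ [inv_letter a])"
    using assms by (intro pres_eq_append pres_eq.refl)
  moreover have "pres_eq S ([b, a] @ [inv_letter a]) [b]"
    using pres_eq.cancel[of S "[b]" a "[]"] by simp
  ultimately have "pres_eq S ([a] @ [b, inv_letter a]) [b]" by (auto intro: pres_eq.trans)
  then show ?thesis by (subst (asm) pres_eq_move_left) (simp add: pres_eq.sym)
qed

lemma ind_comm: assumes "ind a b" shows "[a, b] \<simeq> [b, a]"
proof -
  obtain s e t f where ab: "a = (s, e)" "b = (t, f)" by fastforce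
  have "E s t" using assms by (simp add: ab ind_def)
  have 1: "[(s, e), (t, True)] \<simeq> [(t, True), (s, e)]"
    using comm_pos[OF \<open>E s t\<close>] comm_inv_letter[OF comm_pos[OF \<open>E s t\<close>]]
    by (cases e) (auto simp: inv_letter_def)
  have "[(t, f), (s, e)] \<simeq> [(s, e), (t, f)]"
    using pres_eq.sym[OF 1] comm_inv_letter[OF pres_eq.sym[OF 1]]
    by (cases f) (auto simp: inv_letter_def)
  then show ?thesis by (simp add: ab pres_eq.sym)
qed

lemma teq_imp_eqA: "u \<sim> v \<Longrightarrow> u \<simeq> v"
proof -
  assume "u \<sim> v"
  have "swap_step a b \<Longrightarrow> a \<simeq> b" for a b
    using pres_eq_context[OF ind_comm] by (fastforce simp: swap_step_def)
  with teq_swap_steps[OF \<open>u \<sim> v\<close>] show ?thesis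
    by (induction rule: rtranclp_induct) (auto intro: pres_eq.intros)
qed

text \<open>Van der Waerden's method with reduced words modulo traces as states: in a commutator the
  inner pair can be exchanged by \<open>lmul_comm\<close>, after which everything cancels.\<close>

lemma eqA_foldr_lmul:
  assumes "u \<simeq> v" "reduced s" shows "foldr lmul u s \<sim> foldr lmul v s"
proof (rule pres_eq_action[where eqv = teq and V = reduced])
  fix r s assume "r \<in> R" "reduced s"
  then obtain x y where r: "r = commutator x y" and "E x y" by (auto simp: raag_rels_def)
  define a b where "a = (x, True)" "b = (y, True)"
  have "ind a b" using \<open>E x y\<close> by (simp add: a_b_def ind_def)
  have "lmul (inv_letter a) (lmul (inv_letter b) s) \<sim> lmul (inv_letter b) (lmul (inv_letter a) s)"
    using \<open>ind a b\<close> by (intro lmul_comm) simp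
  then have "foldr lmul r s \<sim> lmul a (lmul b (lmul (inv_letter b) (lmul (inv_letter a) s)))"
    by (auto simp: r commutator_def a_b_def inv_letter_def intro!: lmul_teq)
  also have "\<dots> \<sim> lmul a (lmul (inv_letter a) s)"
    using \<open>reduced s\<close> by (intro lmul_teq lmul_inverse reduced_lmul)
  also have "\<dots> \<sim> s" using \<open>reduced s\<close> by (rule lmul_inverse)
  finally show "foldr lmul r s \<sim> s" .
qed (use assms in \<open>auto intro: reduced_lmul lmul_teq lmul_inverse teq_sym teq_trans\<close>)

lemma eqA_red_teq: "u \<simeq> v \<Longrightarrow> red u \<sim> red v"
  by (simp add: red_def eqA_foldr_lmul)

lemma lmul_eqA: "lmul y w \<simeq> y # w"
proof (cases y w rule: lmul_cases)
  case (cancel w')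
  have "y # w \<simeq> y # inv_letter y # w'" using cancel(1) by (intro pres_eq_Cons teq_imp_eqA)
  moreover have "y # inv_letter y # w' \<simeq> w'" using pres_eq.cancel[of R "[]" y w'] by simp
  moreover have "lmul y w \<simeq> w'" using cancel(2) by (rule teq_imp_eqA)
  ultimately show ?thesis by (blast intro: pres_eq.intros)
qed (simp add: pres_eq.refl)

lemma foldr_lmul_eqA: "foldr lmul u s \<simeq> u @ s"
  by (induction u) (auto intro: lmul_eqA pres_eq_Cons pres_eq.refl pres_eq.trans)

lemma red_eqA: "red w \<simeq> w"
  using foldr_lmul_eqA[of w "[]"] by (simp add: red_def)

text \<open>The normal form theorem: \<open>red\<close> respects equality in the group up to traces
  and leaves reduced words unchanged.\<close>

lemma reduced_eqA_iff: "reduced u \<Longrightarrow> reduced v \<Longrightarrow> u \<simeq> v \<longleftrightarrow> u \<sim> v"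
  using eqA_red_teq[of u v] red_reduced[of u] red_reduced[of v] teq_imp_eqA[of u v] by auto

lemma word_over_red: "word_over A w \<Longrightarrow> word_over A (red w)"
  by (rule word_over_subset[OF set_red])

text \<open>Adjacent vertices are distinct, so pairwise commuting letters belong to different
  generators.\<close>

lemma length_clique:
  assumes "clique D" "word_over {..<n} D" shows "length D \<le> n"
proof -
  have "distinct (map fst D)"
    using assms(1) by (induction D) (auto dest: ind_fst_neq)
  moreover have "set (map fst D) \<subseteq> {..<n}" using assms(2) by (auto simp: word_over_def)
  ultimately have "length (map fst D) \<le> card {..<n}"
    by (metis card_mono distinct_card finite_lessThan)
  then show ?thesis by simp
qed

section \<open>How the lowest layers react to multiplication\<close>

definition low_part :: "nat \<Rightarrow> nat letter list \<Rightarrow> nat letter list" where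
  "low_part k c = low k (red c)"

lemma low_part_cong: "c \<simeq> c' \<Longrightarrow> low_part k c \<simeq> low_part k c'"
  unfolding low_part_def by (rule teq_imp_eqA[OF low_teq[OF eqA_red_teq]])

lemma low_part_0: "low_part 0 c = []"
  by (simp add: low_part_def)

lemma low_part_full: "low_part (length (red c)) c \<simeq> c"
  by (simp add: low_part_def low_eq red_eqA)

lemma low_part_Suc:
  assumes "word_over {..<n} c"
  obtains D where "low_part (Suc k) c \<simeq> D @ low_part k c" "word_over {..<n} D" "length D \<le> n"
proof -
  obtain D where D: "low (Suc k) (red c) \<sim> D @ low k (red c)" "clique D" "set D \<subseteq> set (red c)"
    by (rule low_Suc)
  have "word_over {..<n} D" using word_over_subset[OF D(3)] assms word_over_red by blast
  then show ?thesis using that D length_clique teq_imp_eqA unfolding low_part_def by blast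
qed

text \<open>A level depends only on what stands to the right. Prepending or cancelling
  \<open>y\<close> at the front therefore changes no other level, and only this one letter can enter
  or leave.\<close>

lemma low_part_lmul:
  obtains e where "low_part k (y # c) \<simeq> e @ low_part k c" "set e \<subseteq> {y}" "length e \<le> 1"
proof -
  have red: "red (y # c) = lmul y (red c)" by (simp add: red_def)
  show ?thesis
  proof (cases rule: lmul_cases[where y = y and w = "red c"])
    case (cancel w')
    have c: "low_part k c \<simeq> low k (inv_letter y # w')" and yc: "low_part k (y # c) \<simeq> low k w'"
      unfolding low_part_def red
      by (rule teq_imp_eqA[OF low_teq[OF cancel(1)]], rule teq_imp_eqA[OF low_teq[OF cancel(2)]])
    show ?thesis
    proof (cases "level w' (inv_letter y) < k")
      case True
      have "y # inv_letter y # low k w' \<simeq> low k w'"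
        using pres_eq.cancel[of R "[]" y] by simp
      moreover have "y # low_part k c \<simeq> y # inv_letter y # low k w'"
        using pres_eq_Cons[OF c] True by simp
      ultimately have "[y] @ low_part k c \<simeq> low k w'"
        using pres_eq.trans by simp
      then show ?thesis using that[of "[y]"] pres_eq.trans[OF yc pres_eq.sym] by simp
    next
      case False
      then have "low_part k c \<simeq> low k w'" using c by simp
      then show ?thesis using that[of "[]"] pres_eq.trans[OF yc pres_eq.sym] by simp
    qed
  next
    case cons
    then show ?thesis
      using that[of "[]"] that[of "[y]"]
      by (cases "level (red c) y < k") (auto simp: low_part_def red pres_eq.refl)
  qed
qed

lemma low_part_append_left:
  "\<exists>e. low_part k (u @ c) \<simeq> e @ low_part k c \<and> set e \<subseteq> set u \<and> length e \<le> length u"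
proof (induction u)
  case Nil
  show ?case by (simp add: pres_eq.refl)
next
  case (Cons y u)
  then obtain e where e: "low_part k (u @ c) \<simeq> e @ low_part k c" "set e \<subseteq> set u" "length e \<le> length u"
    by blast
  obtain f where f: "low_part k (y # u @ c) \<simeq> f @ low_part k (u @ c)" "set f \<subseteq> {y}" "length f \<le> 1"
    by (rule low_part_lmul)
  have "low_part k (y # u @ c) \<simeq> f @ e @ low_part k c"
    by (rule pres_eq.trans[OF f(1) pres_eq_append[OF pres_eq.refl e(1)]])
  then show ?case using e f by (intro exI[of _ "f @ e"]) auto
qed

lemma low_part_snoc:
  assumes "word_over {..<n} (c @ [y])"
  obtains D where "low_part k c @ [y] \<simeq> D @ low_part k (c @ [y])" "word_over {..<n} D" "length D \<le> n"
proof -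
  have over: "word_over {..<n} (red c @ [y])" using assms word_over_red by simp
  have c: "red c @ [y] \<simeq> c @ [y]" by (intro pres_eq_append red_eqA pres_eq.refl)
  show ?thesis
  proof (rule reduced_snoc_cases[OF reduced_red[of c], of y])
    assume "reduced (red c @ [y])"
    then have "red (c @ [y]) \<sim> red c @ [y]"
      using eqA_red_teq[OF c] red_reduced teq_sym by metis
    then have *: "low k (red c @ [y]) \<simeq> low_part k (c @ [y])"
      unfolding low_part_def by (rule teq_imp_eqA[OF low_teq[OF teq_sym]])
    obtain D where D: "low k (red c) @ [y] \<sim> D @ low k (red c @ [y])" "clique D"
      "set D \<subseteq> set (red c @ [y])" by (rule low_snoc)
    have "low_part k c @ [y] \<simeq> D @ low_part k (c @ [y])"
      using pres_eq.trans[OF teq_imp_eqA[OF D(1)] pres_eq_append[OF pres_eq.refl *]]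
      by (simp add: low_part_def)
    moreover have "word_over {..<n} D" by (rule word_over_subset[OF D(3) over])
    ultimately show ?thesis using that length_clique[OF D(2)] by blast
  next
    fix w assume w: "red c \<sim> w @ [inv_letter y]"
    have over_w: "word_over {..<n} (w @ [inv_letter y])"
      by (rule word_over_subset[of _ "red c @ [y]"]) (use teq_set[OF w] over in auto)
    note pres_eq.sym[OF c]
    also have "red c @ [y] \<simeq> (w @ [inv_letter y]) @ [y]"
      by (rule pres_eq_append[OF teq_imp_eqA[OF w] pres_eq.refl])
    also have "(w @ [inv_letter y]) @ [y] \<simeq> w" using pres_eq.cancel[of R w "inv_letter y" "[]"] by simp
    finally have "c @ [y] \<simeq> w" .
    moreover have "reduced w"
    proof -
      have "reduced (rev (w @ [inv_letter y]))" by (rule reduced_rev[OF reduced_teq[OF w reduced_red]])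
      then have "reduced (rev w)" using reduced_ConsD by simp
      then show ?thesis using reduced_rev[of "rev w"] by simp
    qed
    ultimately have "red (c @ [y]) \<sim> w" using eqA_red_teq[of "c @ [y]" w] red_reduced by simp
    then have low_w: "low_part k (c @ [y]) \<simeq> low k w"
      unfolding low_part_def by (intro teq_imp_eqA low_teq)
    have low_c: "low_part k c \<simeq> low k (w @ [inv_letter y])"
      unfolding low_part_def by (intro teq_imp_eqA low_teq w)
    \<comment> \<open>The roles are exchanged: \<open>c\<close> arises from \<open>c y\<close> by
      appending the inverse letter. Solving for the required product then turns \<open>D\<close>
      into its inverse.\<close>
    obtain D where D: "low k w @ [inv_letter y] \<sim> D @ low k (w @ [inv_letter y])" "clique D"
      "set D \<subseteq> set (w @ [inv_letter y])" by (rule low_snoc)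
    have over_D: "word_over {..<n} D" by (rule word_over_subset[OF D(3) over_w])
    have "D @ low_part k c \<simeq> D @ low k (w @ [inv_letter y])"
      by (rule pres_eq_append[OF pres_eq.refl low_c])
    also have "D @ low k (w @ [inv_letter y]) \<simeq> low k w @ [inv_letter y]"
      by (rule pres_eq.sym[OF teq_imp_eqA[OF D(1)]])
    also have "low k w @ [inv_letter y] \<simeq> low_part k (c @ [y]) @ [inv_letter y]"
      by (rule pres_eq_append[OF pres_eq.sym[OF low_w] pres_eq.refl])
    finally have "D @ low_part k c \<simeq> low_part k (c @ [y]) @ [inv_letter y]" .
    then have "low_part k c \<simeq> (inv_word D @ low_part k (c @ [y])) @ inv_word [y]"
      using pres_eq_move_left[of R D "low_part k c"] by simp
    then have "low_part k c @ [y] \<simeq> inv_word D @ low_part k (c @ [y])"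
      using pres_eq_move_right by blast
    then show ?thesis using that[of "inv_word D"] over_D length_clique[OF D(2)] by simp
  qed
qed

text \<open>Each appended letter costs one clique, hence the factor \<open>n\<close>.\<close>

lemma low_part_append_right:
  "word_over {..<n} (c @ u) \<Longrightarrow>
    \<exists>e. low_part k c @ u \<simeq> e @ low_part k (c @ u) \<and> word_over {..<n} e \<and> length e \<le> n * length u"
proof (induction u arbitrary: c)
  case Nil
  then show ?case by (auto intro!: exI[of _ "[]"] pres_eq.refl)
next
  case (Cons y u)
  then obtain D where D: "low_part k c @ [y] \<simeq> D @ low_part k (c @ [y])" "word_over {..<n} D" "length D \<le> n"
    using low_part_snoc[of c y k] by auto
  obtain e where e: "low_part k (c @ [y]) @ u \<simeq> e @ low_part k ((c @ [y]) @ u)" "word_over {..<n} e"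
    "length e \<le> n * length u"
    using Cons.IH[of "c @ [y]"] Cons.prems by auto
  have "(low_part k c @ [y]) @ u \<simeq> (D @ low_part k (c @ [y])) @ u"
    by (rule pres_eq_append[OF D(1) pres_eq.refl])
  also have "(D @ low_part k (c @ [y])) @ u \<simeq> D @ (e @ low_part k ((c @ [y]) @ u))"
    using pres_eq_append[OF pres_eq.refl e(1)] by simp
  finally have "low_part k c @ y # u \<simeq> (D @ e) @ low_part k (c @ y # u)" by simp
  then show ?case using D e by (intro exI[of _ "D @ e"]) auto
qed

end

section \<open>Letter symmetries and chains of twisted conjugates\<close>

locale raag_symmetry = raag +
  fixes f :: "nat letter \<Rightarrow> nat letter"
  assumes f_ind: "ind (f a) (f b) \<longleftrightarrow> ind a b"
    and f_inv: "f (inv_letter a) = inv_letter (f a)"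
    and f_over: "fst a < n \<Longrightarrow> fst (f a) < n"
    and f_inj: "f a = f b \<Longrightarrow> a = b"
begin

lemma word_over_map: "word_over {..<n} w \<Longrightarrow> word_over {..<n} (map f w)"
  by (auto simp: word_over_def f_over)

lemma map_eqA: "u \<simeq> v \<Longrightarrow> map f u \<simeq> map f v"
proof (induction rule: pres_eq.induct)
  case (cancel u a w)
  show ?case using pres_eq.cancel[of R "map f u" "f a" "map f w"] by (simp add: f_inv)
next
  case (relator r u w)
  then obtain s t where r: "r = commutator s t" "E s t" by (auto simp: raag_rels_def)
  define a b where "a = f (s, True)" "b = f (t, True)"
  have "ind a b" unfolding a_b_def f_ind using r by (simp add: ind_def)
  have "map f r = [a, b] @ [inv_letter a, inv_letter b]"
    using f_inv[of "(s, True)"] f_inv[of "(t, True)"]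
    by (simp add: r commutator_def a_b_def inv_letter_def)
  moreover have "[a, b] @ [inv_letter a, inv_letter b] \<simeq> [b, a] @ inv_word [b, a]"
    using pres_eq_append[OF ind_comm[OF \<open>ind a b\<close>] pres_eq.refl] by simp
  ultimately have "map f r \<simeq> [b, a] @ inv_word [b, a]" by simp
  also note pres_eq_inv_right
  finally have "map f r \<simeq> []" .
  then show ?case using pres_eq_context[of R "map f r" "[]" "map f u" "map f w"] by simp
qed (auto intro: pres_eq.intros)

text \<open>A cancelling pair in a trace of \<open>map f w\<close> pulls back to \<open>w\<close>:
  trace equivalence preserves the letters, so all lie in the range of \<open>f\<close>, and
  \<open>f\<close> is injective and reflects independence and inversion.\<close>

lemma reduced_map: assumes "reduced w" shows "reduced (map f w)"
  unfolding reduced_def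
proof safe
  fix p y q assume *: "map f w \<sim> p @ y # inv_letter y # q"
  have "set (p @ y # inv_letter y # q) \<subseteq> range f" unfolding teq_set[OF *, symmetric] by auto
  then have "\<forall>b \<in> set (p @ y # inv_letter y # q). \<exists>a. b = f a" by blast
  then obtain v where v: "p @ y # inv_letter y # q = map f v"
    unfolding ex_map_conv[symmetric] by blast
  have inj: "inj f" by (rule injI) (rule f_inj)
  have "w \<sim> v"
    unfolding teq_def
  proof (intro allI impI)
    fix a b assume "\<not> ind a b"
    then have "filter (\<lambda>c. c = f a \<or> c = f b) (map f w) = filter (\<lambda>c. c = f a \<or> c = f b) (map f v)"
      using *[unfolded v teq_def, rule_format, of "f a" "f b"] by (simp add: f_ind)
    then have "map f (filter (\<lambda>c. c = a \<or> c = b) w) = map f (filter (\<lambda>c. c = a \<or> c = b) v)"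
      using inj by (simp add: filter_map o_def inj_eq)
    then show "filter (\<lambda>c. c = a \<or> c = b) w = filter (\<lambda>c. c = a \<or> c = b) v"
      using inj by (simp add: inj_map_eq_map)
  qed
  moreover obtain p' z z' q' where "v = p' @ z # z' # q'" "y = f z" "inv_letter y = f z'"
    using v by (fastforce simp: map_eq_append_conv append_eq_map_conv Cons_eq_map_conv)
  moreover from this have "z' = inv_letter z" using f_inv f_inj by metis
  ultimately show False using assms unfolding reduced_def by blast
qed

lemma red_map: "red (map f c) \<sim> map f (red c)"
  using eqA_red_teq[OF map_eqA[OF red_eqA[of c]]] red_reduced[OF reduced_map[OF reduced_red[of c]]]
    teq_sym by simp

lemma low_part_map: "low_part k (map f c) \<simeq> map f (low_part k c)"
  unfolding low_part_def using teq_imp_eqA[OF low_teq[OF red_map]] low_map f_ind by simp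

text \<open>Edges of a finite graph on words of length at most \<open>L\<close>:
  \<open>h = D g f(D)^-1\<close> in the group. Length \<open>n\<close> suffices for \<open>D\<close>
  because a layer has at most \<open>n\<close> letters.\<close>

definition short_conj :: "nat \<Rightarrow> (nat letter list \<times> nat letter list) set" where
  "short_conj L = {(g, h). (set g \<subseteq> {..<n} \<times> UNIV \<and> length g \<le> L) \<and> (set h \<subseteq> {..<n} \<times> UNIV \<and> length h \<le> L) \<and>
     (\<exists>D. word_over {..<n} D \<and> length D \<le> n \<and> D @ g \<simeq> h @ map f D)}"

lemma card_lists_le:
  assumes "finite A" shows "card {xs. set xs \<subseteq> A \<and> length xs \<le> L} \<le> (card A + 1) ^ L"
proof -
  have "(\<Sum>i\<le>L. q ^ i) \<le> (q + 1) ^ L" for q :: nat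
  proof (induction L)
    case (Suc L)
    have "q ^ Suc L \<le> q * (q + 1) ^ L" using power_mono[of q "q + 1" L] by simp
    then have "(\<Sum>i\<le>L. q ^ i) + q ^ Suc L \<le> (q + 1) ^ L + q * (q + 1) ^ L"
      using Suc by (rule add_mono[rotated])
    then show ?case by simp
  qed simp
  then show ?thesis by (simp add: card_lists_length_le[OF assms])
qed

lemma short_conj_finite: "finite (short_conj L)"
  and card_short_conj: "card (short_conj L) \<le> ((2 * n + 1) ^ L) ^ 2"
proof -
  let ?W = "{xs. set xs \<subseteq> {..<n} \<times> (UNIV :: bool set) \<and> length xs \<le> L}"
  have W: "finite ?W" by (rule finite_lists_length_le) simp
  have sub: "short_conj L \<subseteq> ?W \<times> ?W" by (auto simp: short_conj_def)
  show "finite (short_conj L)" by (rule finite_subset[OF sub]) (use W in simp)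
  have "card ?W \<le> (2 * n + 1) ^ L"
    using card_lists_le[of "{..<n} \<times> (UNIV :: bool set)" L] by (simp add: card_cartesian_product mult.commute)
  moreover have "card (short_conj L) \<le> card ?W * card ?W"
    using card_mono[OF _ sub] W by (simp add: card_cartesian_product)
  ultimately show "card (short_conj L) \<le> ((2 * n + 1) ^ L) ^ 2"
    unfolding power2_eq_square using mult_le_mono order_trans by blast
qed

lemma short_conj_relpow:
  "(g, h) \<in> short_conj L ^^ j \<Longrightarrow> \<exists>c. word_over {..<n} c \<and> length c \<le> n * j \<and> c @ g \<simeq> h @ map f c"
proof (induction j arbitrary: h)
  case 0
  then show ?case by (auto intro!: exI[of _ "[]"] pres_eq.refl)
next
  case (Suc j)
  then obtain h' where h': "(g, h') \<in> short_conj L ^^ j" "(h', h) \<in> short_conj L" by auto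
  obtain c where c: "word_over {..<n} c" "length c \<le> n * j" "c @ g \<simeq> h' @ map f c"
    using Suc.IH[OF h'(1)] by blast
  obtain D where D: "word_over {..<n} D" "length D \<le> n" "D @ h' \<simeq> h @ map f D"
    using h'(2) by (auto simp: short_conj_def)
  have "D @ (c @ g) \<simeq> D @ (h' @ map f c)" by (rule pres_eq_append[OF pres_eq.refl c(3)])
  also have "D @ (h' @ map f c) \<simeq> (h @ map f D) @ map f c"
    using pres_eq_append[OF D(3) pres_eq.refl] by simp
  finally have "(D @ c) @ g \<simeq> h @ map f (D @ c)" by simp
  then show ?case using c D by (intro exI[of _ "D @ c"]) auto
qed

theorem twisted_conjugator_bound:
  assumes a: "word_over {..<n} a" and b: "word_over {..<n} b" and d: "word_over {..<n} d"
    and conj: "d @ a \<simeq> b @ map f d"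
  obtains c where "word_over {..<n} c" "length c \<le> conj_bound n (length a) (length b)" "c @ a \<simeq> b @ map f c"
proof -
  define L where "L = n * length a + length b"
  let ?P = "\<lambda>k g. word_over {..<n} g \<and> length g \<le> L \<and> low_part k d @ a \<simeq> g @ map f (low_part k d)"
  \<comment> \<open>With \<open>P\<close> for \<open>low_part k\<close>:
    \<open>P(d) a = e P(d a) = e P(b f(d)) = e e' f(P(d))\<close>. So \<open>e e'\<close> is the
    twisted conjugate, with \<open>n * length a\<close> bounding \<open>e\<close> (right
    multiplication) and \<open>length b\<close> bounding \<open>e'\<close> (left
    multiplication).\<close>
  have "\<exists>g. ?P k g" for k
  proof -
    obtain e where e: "low_part k d @ a \<simeq> e @ low_part k (d @ a)" "word_over {..<n} e" "length e \<le> n * length a"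
      using low_part_append_right[of d a k] a d by auto
    obtain e' where e': "low_part k (b @ map f d) \<simeq> e' @ low_part k (map f d)" "set e' \<subseteq> set b" "length e' \<le> length b"
      using low_part_append_left[of k b "map f d"] by blast
    have "low_part k (d @ a) \<simeq> low_part k (b @ map f d)" by (rule low_part_cong[OF conj])
    then have "low_part k (d @ a) \<simeq> e' @ low_part k (map f d)" using e'(1) by (rule pres_eq.trans)
    moreover have "e' @ low_part k (map f d) \<simeq> e' @ map f (low_part k d)"
      by (rule pres_eq_append[OF pres_eq.refl low_part_map])
    ultimately have "e @ low_part k (d @ a) \<simeq> e @ e' @ map f (low_part k d)"
      by (intro pres_eq_append[OF pres_eq.refl]) (rule pres_eq.trans)
    then have "low_part k d @ a \<simeq> (e @ e') @ map f (low_part k d)"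
      using pres_eq.trans[OF e(1)] by simp
    moreover have "word_over {..<n} e'" by (rule word_over_subset[OF e'(2) b])
    ultimately show ?thesis using e e' unfolding L_def by (intro exI[of _ "e @ e'"]) auto
  qed
  then obtain G where G: "\<And>k. ?P k (G k)" by metis
  have over: "word_over {..<n} w \<longleftrightarrow> set w \<subseteq> {..<n} \<times> UNIV" for w :: "nat letter list"
    by (auto simp: word_over_def)
  define K where "K = length (red d)"
  \<comment> \<open>The layer \<open>D\<close> that separates \<open>low_part k d\<close> from
    \<open>low_part (Suc k) d\<close> also conjugates \<open>G k\<close> to
    \<open>G (Suc k)\<close>.\<close>
  have "(G k, G (Suc k)) \<in> short_conj L" for k
  proof -
    obtain D where D: "low_part (Suc k) d \<simeq> D @ low_part k d" "word_over {..<n} D" "length D \<le> n"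
      using low_part_Suc[OF d] by blast
    have "D @ (low_part k d @ a) \<simeq> D @ (G k @ map f (low_part k d))"
      by (rule pres_eq_append[OF pres_eq.refl]) (use G in blast)
    moreover have "low_part (Suc k) d @ a \<simeq> (D @ low_part k d) @ a"
      by (rule pres_eq_append[OF D(1) pres_eq.refl])
    moreover have "low_part (Suc k) d @ a \<simeq> G (Suc k) @ map f (low_part (Suc k) d)" using G by blast
    moreover have "G (Suc k) @ map f (low_part (Suc k) d) \<simeq> G (Suc k) @ map f (D @ low_part k d)"
      by (rule pres_eq_append[OF pres_eq.refl map_eqA[OF D(1)]])
    ultimately have "(D @ G k) @ map f (low_part k d) \<simeq> (G (Suc k) @ map f D) @ map f (low_part k d)"
      by simp (meson pres_eq.sym pres_eq.trans)
    then have "D @ G k \<simeq> G (Suc k) @ map f D" by (rule pres_eq_cancel_right)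
    then show ?thesis using G[of k] G[of "Suc k"] D by (auto simp: short_conj_def over[symmetric])
  qed
  then have GK: "(G 0, G K) \<in> (short_conj L)\<^sup>*"
    by (induction K) (auto intro: rtrancl_into_rtrancl)
  \<comment> \<open>The ends of the walk are the conjugates by no layer and by all layers. They
    agree with \<open>a\<close> and \<open>b\<close> in the group, possibly not as words.\<close>
  have "G 0 \<simeq> a" using G[of 0] by (simp add: low_part_0 pres_eq.sym)
  have "G K \<simeq> b"
  proof -
    have K: "low_part K d \<simeq> d" unfolding K_def by (rule low_part_full)
    have "low_part K d @ a \<simeq> G K @ map f (low_part K d)" using G by blast
    moreover have "low_part K d @ a \<simeq> d @ a" by (rule pres_eq_append[OF K pres_eq.refl])
    moreover have "G K @ map f (low_part K d) \<simeq> G K @ map f d"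
      by (rule pres_eq_append[OF pres_eq.refl map_eqA[OF K]])
    ultimately have "G K @ map f d \<simeq> b @ map f d" using conj by (meson pres_eq.sym pres_eq.trans)
    then show ?thesis by (rule pres_eq_cancel_right)
  qed
  from GK obtain j where j: "j \<le> card (short_conj L)" "(G 0, G K) \<in> short_conj L ^^ j"
    using rtrancl_finite_eq_relpow[OF short_conj_finite[of L]] by auto
  obtain c where c: "word_over {..<n} c" "length c \<le> n * j" "c @ G 0 \<simeq> G K @ map f c"
    using short_conj_relpow[OF j(2)] by blast
  have "c @ a \<simeq> c @ G 0" by (rule pres_eq_append[OF pres_eq.refl pres_eq.sym[OF \<open>G 0 \<simeq> a\<close>]])
  moreover have "G K @ map f c \<simeq> b @ map f c" by (rule pres_eq_append[OF \<open>G K \<simeq> b\<close> pres_eq.refl])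
  ultimately have "c @ a \<simeq> b @ map f c" using c(3) by (meson pres_eq.trans)
  moreover have "n * j \<le> conj_bound n (length a) (length b)"
    unfolding conj_bound_def L_def[symmetric] using j(1) card_short_conj[of L] by (intro mult_le_mono) simp_all
  ultimately show ?thesis using that c by force
qed

text \<open>Passing \<open>t^k\<close> across a word twists it by a power of the automorphism, so
  the bound is needed for every power.\<close>

lemma raag_symmetry_funpow: "raag_symmetry n E (f ^^ k)"
proof (induction k)
  case (Suc k)
  then interpret fk: raag_symmetry n E "f ^^ k" .
  show ?case
  proof
    show "fst ((f ^^ Suc k) a) < n" if "fst a < n" for a
      using f_over[OF fk.f_over[OF that]] by simp
    show "a = b" if "(f ^^ Suc k) a = (f ^^ Suc k) b" for a b
      using that by (auto dest!: f_inj fk.f_inj)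
  qed (simp_all add: f_ind fk.f_ind f_inv fk.f_inv)
qed (unfold_locales, simp_all)

lemma map_teq: "reduced u \<Longrightarrow> reduced v \<Longrightarrow> u \<sim> v \<Longrightarrow> map f u \<sim> map f v"
  using reduced_eqA_iff reduced_map map_eqA by blast

end

section \<open>The semidirect product\<close>

lemma pres_eq_inv_word: assumes "pres_eq R u v" shows "pres_eq R (inv_word u) (inv_word v)"
proof -
  have "pres_eq R (inv_word v @ u) (inv_word v @ v)" by (rule pres_eq_append[OF pres_eq.refl assms])
  also have "pres_eq R (inv_word v @ v) []" by (rule pres_eq_inv_left)
  finally have "pres_eq R (inv_word v) (inv_word u)" by (simp add: pres_eq_move_right)
  then show ?thesis by (rule pres_eq.sym)
qed

lemma word_over_subst:
  "(\<And>x. x \<in> A \<Longrightarrow> word_over B (phi x)) \<Longrightarrow> word_over A w \<Longrightarrow> word_over B (subst phi w)"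
  by (induction w) (auto simp: subst_def)

section \<open>Length-preserving automorphisms as permutations of letters\<close>

context raag
begin

lemma fst_eq_iff: "fst a = fst b \<longleftrightarrow> a = b \<or> a = inv_letter b"
  by (auto simp: inv_letter_def prod_eq_iff)

lemma single_eqA_iff: "[a] \<simeq> [b] \<longleftrightarrow> a = b"
  using reduced_eqA_iff[of "[a]" "[b]"] teq_set[of "[a]" "[b]"] by auto

text \<open>Independence is visible in the group: \<open>[a, b]\<close> and \<open>[b, a]\<close>
  are reduced for distinct generators, and dependent letters keep their order in a trace. This is
  how an automorphism is seen to respect the graph.\<close>

lemma comm_iff: "[a, b] \<simeq> [b, a] \<longleftrightarrow> ind a b \<or> fst a = fst b"
proof
  assume comm: "[a, b] \<simeq> [b, a]"
  show "ind a b \<or> fst a = fst b"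
  proof (rule ccontr)
    assume no: "\<not> (ind a b \<or> fst a = fst b)"
    have red: "reduced [x, y]" if "fst x \<noteq> fst y" for x y
    proof (rule reduced_ConsI)
      fix w assume "[y] \<sim> inv_letter x # w"
      then have "set [y] = set (inv_letter x # w)" by (rule teq_set)
      then show False using that by auto
    qed simp
    have "[a, b] \<sim> [b, a]"
      using comm reduced_eqA_iff[OF red[of a b] red[of b a]] no by simp
    from this[unfolded teq_def, rule_format, of a b] no
    have "filter (\<lambda>c. c = a \<or> c = b) [a, b] = filter (\<lambda>c. c = a \<or> c = b) [b, a]"
      by blast
    from arg_cong[OF this, of hd] have "a = b" by simp
    then show False using no by simp
  qed
next
  have "[inv_letter b, b] \<simeq> []" "[b, inv_letter b] \<simeq> []"
    using pres_eq.cancel[of R "[]" b "[]"] pres_eq.cancel[of R "[]" "inv_letter b" "[]"] by simp_all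
  then have "[inv_letter b, b] \<simeq> [b, inv_letter b]" by (metis pres_eq.trans pres_eq.sym)
  moreover assume "ind a b \<or> fst a = fst b"
  ultimately show "[a, b] \<simeq> [b, a]" using ind_comm[of a b] by (auto simp: fst_eq_iff pres_eq.refl)
qed

text \<open>A length-preserving automorphism sends each generator to an element of length at most one,
  hence, being injective, to a letter.\<close>

lemma length_preserving_letter:
  assumes aut: "raag_aut n E phi" and lp: "length_preserving n E phi" and x: "x < n"
  obtains b where "phi x \<simeq> [b]" "fst b < n"
proof -
  let ?x = "[(x, True)]"
  have over: "word_over {..<n} ?x" "word_over {..<n} (phi x)"
    using x aut by (auto simp: raag_aut_def)
  have subst: "subst phi ?x = phi x" by (simp add: subst_def)
  have "word_length R {..<n} ?x \<le> 1"
    unfolding word_length_def by (rule Least_le) (use over pres_eq.refl in fastforce)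
  moreover have "word_length R {..<n} (phi x) = word_length R {..<n} ?x"
    using lp over(1) subst unfolding length_preserving_def by metis
  moreover have "\<exists>w. word_over {..<n} w \<and> phi x \<simeq> w \<and> length w = word_length R {..<n} (phi x)"
    unfolding word_length_def
    by (rule LeastI[of _ "length (phi x)"]) (use over pres_eq.refl in blast)
  ultimately obtain w where w: "word_over {..<n} w" "phi x \<simeq> w" "length w \<le> 1" by auto
  show ?thesis
  proof (cases w)
    case Nil
    then have "subst phi ?x \<simeq> subst phi []" using w subst by (simp add: subst_def)
    then have "?x \<simeq> []" using aut over(1) unfolding raag_aut_def by fastforce
    then have "?x \<sim> []" by (subst (asm) reduced_eqA_iff) auto
    then show ?thesis using teq_length by fastforce
  next
    case (Cons b v)
    then show ?thesis using w that by auto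
  qed
qed

text \<open>An automorphism preserves and reflects equality in the group. Applied to
  \<open>[a]\<close> and \<open>[b]\<close> this makes \<open>s\<close> injective; applied to
  \<open>[a, b]\<close> and \<open>[b, a]\<close> it makes \<open>s\<close> preserve
  independence.\<close>

lemma letter_permutation:
  assumes aut: "raag_aut n E phi" and lp: "length_preserving n E phi" and pw: "aut_power_id n E phi m"
  obtains s where "raag_symmetry n E s" "\<And>x. x < n \<Longrightarrow> phi x \<simeq> [s (x, True)]"
    "\<And>a. \<not> fst a < n \<Longrightarrow> s a = a" "\<And>a. (s ^^ m) a = a"
proof -
  have "\<exists>b. x < n \<longrightarrow> phi x \<simeq> [b] \<and> fst b < n" for x
    using length_preserving_letter[OF aut lp] by metis
  then obtain g where g: "\<And>x. x < n \<Longrightarrow> phi x \<simeq> [g x]" "\<And>x. x < n \<Longrightarrow> fst (g x) < n" by metis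
  \<comment> \<open>The identity outside the generators makes \<open>s\<close> total, keeps it a
    bijection of finite order, and lets it differ from the identity at finitely many letters
    only.\<close>
  define s where "s a = (if fst a < n then if snd a then g (fst a) else inv_letter (g (fst a)) else a)" for a
  have s_inv: "s (inv_letter a) = inv_letter (s a)" for a
    by (auto simp: s_def inv_letter_def)
  have s_over: "fst (s a) < n \<longleftrightarrow> fst a < n" for a
    by (auto simp: s_def g)
  have phi_over: "x < n \<Longrightarrow> word_over {..<n} (phi x)" for x
    using aut by (auto simp: raag_aut_def)
  have subst_over: "word_over {..<n} (subst phi w)" if "word_over {..<n} w" for w
    using word_over_subst[of "{..<n}" "{..<n}" phi w] phi_over that by simp
  have subst_eq: "word_over {..<n} w \<Longrightarrow> subst phi w \<simeq> map s w" for w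
  proof (induction w)
    case Nil
    show ?case by (simp add: subst_def pres_eq.refl)
  next
    case (Cons a w)
    then have "fst a < n" by simp
    then have "(if snd a then phi (fst a) else inv_word (phi (fst a))) \<simeq> [s a]"
      using g(1) pres_eq_inv_word[OF g(1)] by (simp add: s_def)
    then show ?case using Cons pres_eq_append[of R _ "[s a]" "subst phi w" "map s w"]
      by (simp add: subst_def)
  qed
  have reflect: "u \<simeq> v \<longleftrightarrow> map s u \<simeq> map s v" if "word_over {..<n} u" "word_over {..<n} v" for u v
  proof -
    have "u \<simeq> v \<longleftrightarrow> subst phi u \<simeq> subst phi v" using aut that unfolding raag_aut_def by blast
    also have "\<dots> \<longleftrightarrow> map s u \<simeq> map s v" using subst_eq that by (meson pres_eq.sym pres_eq.trans)
    finally show ?thesis .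
  qed
  have s_inj: "a = b" if "s a = s b" for a b
  proof (cases "fst a < n")
    case True
    then have "fst b < n" using s_over that by metis
    have "[a] \<simeq> [b] \<longleftrightarrow> map s [a] \<simeq> map s [b]" by (rule reflect) (use True \<open>fst b < n\<close> in auto)
    then show ?thesis using that by (simp add: single_eqA_iff)
  next
    case False
    then have "\<not> fst b < n" using s_over that by metis
    then show ?thesis using False that by (simp add: s_def)
  qed
  have s_fst: "fst (s a) = fst (s b) \<longleftrightarrow> fst a = fst b" for a b
    using s_inj[of a b] s_inj[of a "inv_letter b"] s_inv[of b] unfolding fst_eq_iff by auto
  have s_ind: "ind (s a) (s b) \<longleftrightarrow> ind a b" for a b
  proof (cases "fst a < n \<and> fst b < n")
    case True
    then have "[a, b] \<simeq> [b, a] \<longleftrightarrow> map s [a, b] \<simeq> map s [b, a]" by (intro reflect) auto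
    then have "ind (s a) (s b) \<or> fst (s a) = fst (s b) \<longleftrightarrow> ind a b \<or> fst a = fst b"
      by (simp add: comm_iff)
    then show ?thesis using ind_fst_neq s_fst by metis
  next
    case False
    then show ?thesis using graph s_over unfolding ind_def simple_graph_def by metis
  qed
  interpret s: raag_symmetry n E s
    by unfold_locales (use s_ind s_inv s_over s_inj in blast)+
  have over_x: "word_over {..<n} ((subst phi ^^ k) [(x, True)])" if "x < n" for x k
    using that by (induction k) (auto intro: subst_over)
  have pow: "(subst phi ^^ k) [(x, True)] \<simeq> [(s ^^ k) (x, True)]" if "x < n" for x k
  proof (induction k)
    case (Suc k)
    have "(subst phi ^^ Suc k) [(x, True)] \<simeq> map s ((subst phi ^^ k) [(x, True)])"
      using subst_eq over_x[OF that] by simp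
    also have "map s ((subst phi ^^ k) [(x, True)]) \<simeq> map s [(s ^^ k) (x, True)]"
      by (rule s.map_eqA[OF Suc])
    finally show ?case by simp
  qed (simp add: pres_eq.refl)
  have id_True: "(s ^^ m) (x, True) = (x, True)" if "x < n" for x
  proof -
    have "[(s ^^ m) (x, True)] \<simeq> (subst phi ^^ m) [(x, True)]" by (rule pres_eq.sym[OF pow[OF that]])
    also have "(subst phi ^^ m) [(x, True)] \<simeq> [(x, True)]" using pw that unfolding aut_power_id_def by blast
    finally show ?thesis by (simp add: single_eqA_iff)
  qed
  interpret sm: raag_symmetry n E "s ^^ m" by (rule s.raag_symmetry_funpow)
  have "(s ^^ m) a = a" for a
  proof (cases "fst a < n")
    case True
    show ?thesis
    proof (cases "snd a")
      case True
      then show ?thesis using id_True[OF \<open>fst a < n\<close>] by (metis prod.collapse)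
    next
      case False
      then have "a = inv_letter (fst a, True)" by (simp add: inv_letter_def prod_eq_iff)
      then show ?thesis using id_True[OF \<open>fst a < n\<close>] sm.f_inv by metis
    qed
  next
    case False
    then have "s a = a" by (simp add: s_def)
    then show ?thesis by (induction m) auto
  qed
  moreover have "phi x \<simeq> [s (x, True)]" if "x < n" for x using g that by (simp add: s_def)
  moreover have "\<not> fst a < n \<Longrightarrow> s a = a" for a by (simp add: s_def)
  ultimately show ?thesis using that s.raag_symmetry_axioms by blast
qed

end

section \<open>Normal forms in the semidirect product\<close>

locale raag_semidirect = raag_symmetry +
  fixes m :: nat and phi :: "nat \<Rightarrow> nat letter list"
  assumes m_pos: "0 < m"
    and f_order: "(f ^^ m) a = a"
    and phi_over: "x < n \<Longrightarrow> word_over {..<n} (phi x)"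
    and phi_f: "x < n \<Longrightarrow> phi x \<simeq> [f (x, True)]"
begin

abbreviation "G \<equiv> semidirect_rels n E phi m"

abbreviation eqG (infix "\<cong>" 50) where "u \<cong> v \<equiv> pres_eq G u v"

abbreviation "t \<equiv> (None, True) :: nat option letter"

abbreviation "t' \<equiv> (None, False) :: nat option letter"

definition mp :: nat where
  "mp = m - 1"

lemma Suc_mp [simp]: "Suc mp = m"
  using m_pos by (simp add: mp_def)

text \<open>The inverse of \<open>f\<close>, written as a power so that it is again a
  symmetry.\<close>

definition fi :: "nat letter \<Rightarrow> nat letter" where
  "fi = f ^^ mp"

lemma f_fi [simp]: "f (fi a) = a"
proof -
  have "f (fi a) = (f ^^ Suc mp) a" by (simp add: fi_def del: Suc_mp)
  then show ?thesis using f_order by simp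
qed

lemma fi_f [simp]: "fi (f a) = a"
proof -
  have "fi (f a) = (f ^^ Suc mp) a" by (simp add: fi_def funpow_swap1 del: Suc_mp)
  then show ?thesis using f_order by simp
qed

lemma fi_order: "fi ^^ m = id"
proof
  fix a
  have "((f ^^ m) ^^ k) a = a" for k by (induction k) (simp_all add: f_order)
  from this[of mp] show "(fi ^^ m) a = id a" by (simp add: fi_def funpow_mult mult.commute[of m])
qed

lemma f_comp_fi [simp]: "f \<circ> fi = id" "fi \<circ> f = id"
  by auto

sublocale fi: raag_symmetry n E fi
  unfolding fi_def by (rule raag_symmetry_funpow)

text \<open>The state \<open>(w, i)\<close> stands for \<open>w t^i\<close>. Since
  \<open>t^-1 x t = f(x)\<close>, moving \<open>t\<close> to the right across \<open>w\<close>
  applies \<open>fi\<close>, and \<open>t'\<close>, which is \<open>t^mp\<close>, applies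
  \<open>f\<close>.\<close>

fun act :: "nat option letter \<Rightarrow> nat letter list \<times> nat \<Rightarrow> nat letter list \<times> nat" where
  "act (Some x, e) (w, i) = (lmul (x, e) w, i)"
| "act (None, True) (w, i) = (map fi w, (i + 1) mod m)"
| "act (None, False) (w, i) = (map f w, (i + mp) mod m)"

definition valid :: "nat letter list \<times> nat \<Rightarrow> bool" where
  "valid s \<longleftrightarrow> reduced (fst s) \<and> snd s < m"

definition equ :: "nat letter list \<times> nat \<Rightarrow> nat letter list \<times> nat \<Rightarrow> bool" where
  "equ s r \<longleftrightarrow> fst s \<sim> fst r \<and> snd s = snd r"

lemma lift_simps [simp]:
  "lift_word [] = []" "lift_word (a # w) = (Some (fst a), snd a) # lift_word w"
  "lift_word (u @ v) = lift_word u @ lift_word v"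
  "inv_word (lift_word w) = lift_word (inv_word w)"
  "length (lift_word w) = length w"
  by (simp_all add: lift_word_def inv_word_def rev_map inv_letter_def)

lemma foldr_act_lift: "foldr act (lift_word u) (w, i) = (foldr lmul u w, i)"
  by (induction u) auto

lemma foldr_act_t: "i < m \<Longrightarrow> foldr act (replicate k t) (w, i) = (map (fi ^^ k) w, (i + k) mod m)"
  by (induction k) (auto simp: mod_simps)

lemma lift_commutator: "commutator (Some x) (Some y) = lift_word (commutator x y)"
  by (simp add: commutator_def)

lemma valid_act: "valid s \<Longrightarrow> valid (act a s)"
  by (cases "(a, s)" rule: act.cases) (auto simp: valid_def reduced_lmul reduced_map fi.reduced_map m_pos)

lemma equ_act: "valid s \<Longrightarrow> valid r \<Longrightarrow> equ s r \<Longrightarrow> equ (act a s) (act a r)"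
  by (cases "(a, s)" rule: act.cases; cases r)
    (auto simp: valid_def equ_def lmul_teq map_teq fi.map_teq)

lemma mod_shift: "i < m \<Longrightarrow> Suc (i + mp) mod m = i" "i < m \<Longrightarrow> (Suc i mod m + mp) mod m = i"
proof -
  assume "i < m"
  have "Suc (i + mp) = i + m" using Suc_mp by linarith
  then have "Suc (i + mp) mod m = (i + m) mod m" by (rule arg_cong)
  with \<open>i < m\<close> show "Suc (i + mp) mod m = i" by simp
  then show "(Suc i mod m + mp) mod m = i" by (simp add: mod_add_left_eq)
qed

lemma act_inverse: assumes "valid s" shows "equ (act a (act (inv_letter a) s)) s"
proof -
  obtain w i where s: "s = (w, i)" "reduced w" "i < m"
    using assms by (cases s) (auto simp: valid_def)
  consider x e where "a = (Some x, e)" | "a = t" | "a = t'"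
    by (cases a; cases "fst a"; cases "snd a") auto
  then show ?thesis
  proof cases
    case (1 x e)
    then show ?thesis using lmul_inverse[OF s(2), of "(x, e)"] by (simp add: s equ_def inv_letter_def)
  next
    case 2
    then show ?thesis using mod_shift(1)[OF s(3)] by (simp add: s equ_def inv_letter_def mod_Suc_eq)
  next
    case 3
    then show ?thesis using mod_shift(2)[OF s(3)] by (simp add: s equ_def inv_letter_def)
  qed
qed

lemma act_relator: assumes "r \<in> G" "valid s" shows "equ (foldr act r s) s"
proof -
  obtain w i where s: "s = (w, i)" by fastforce
  have w: "reduced w" "i < m" using assms(2) by (auto simp: s valid_def)
  from assms(1) consider x y where "r = commutator (Some x) (Some y)" "E x y"
    | "r = replicate m t"
    | x where "r = [t', (Some x, True), t] @ inv_word (lift_word (phi x))" "x < n"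
    unfolding semidirect_rels_def by blast
  then show ?thesis
  proof cases
    case 1
    have "commutator x y \<in> R" using 1 by (auto simp: raag_rels_def)
    then have "commutator x y \<simeq> []" using pres_eq.relator[of _ R "[]" "[]"] by simp
    from eqA_foldr_lmul[OF this w(1)] show ?thesis
      unfolding 1 s lift_commutator foldr_act_lift equ_def by simp
  next
    case 2
    show ?thesis
      unfolding 2 s foldr_act_t[OF w(2)] fi_order using w(2) by (simp add: equ_def)
  next
    case 3
    \<comment> \<open>Read from the right, the relator sends \<open>w\<close> to
      \<open>f(x fi(phi(x)^-1 w)) = f(x) phi(x)^-1 w\<close>, which is \<open>w\<close> because
      \<open>phi x\<close> and \<open>f(x)\<close> agree in the group.\<close>
    define w1 where "w1 = foldr lmul (inv_word (phi x)) w"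
    have w1: "reduced w1" unfolding w1_def by (rule reduced_foldr_lmul[OF w(1)])
    have "foldr act r s = (map f (lmul (x, True) (map fi w1)), i)"
      using mod_shift(2)[OF w(2)] by (simp add: 3 s foldr_act_lift w1_def)
    moreover have "map f (lmul (x, True) (map fi w1)) \<sim> w"
    proof -
      have "map f (lmul (x, True) (map fi w1)) \<simeq> map f ((x, True) # map fi w1)"
        by (rule map_eqA[OF lmul_eqA])
      also have "map f ((x, True) # map fi w1) = [f (x, True)] @ w1" by simp
      also have "[f (x, True)] @ w1 \<simeq> phi x @ (inv_word (phi x) @ w)"
        unfolding w1_def by (rule pres_eq_append[OF pres_eq.sym[OF phi_f[OF 3(2)]] foldr_lmul_eqA])
      also have "phi x @ (inv_word (phi x) @ w) \<simeq> w"
        using pres_eq_append[OF pres_eq_inv_right pres_eq.refl] by fastforce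
      finally have "map f (lmul (x, True) (map fi w1)) \<simeq> w" .
      moreover have "reduced (map f (lmul (x, True) (map fi w1)))"
        by (intro reduced_map reduced_lmul fi.reduced_map w1)
      ultimately show ?thesis using reduced_eqA_iff[OF _ w(1)] by blast
    qed
    ultimately show ?thesis by (simp add: equ_def s)
  qed
qed

text \<open>The normal form \<open>a t^i\<close> of \<open>u\<close>, obtained by acting on the
  identity.\<close>

definition ev :: "nat option letter list \<Rightarrow> nat letter list \<times> nat" where
  "ev u = foldr act u ([], 0)"

lemma ev_cong: "u \<cong> v \<Longrightarrow> equ (ev u) (ev v)"
  unfolding ev_def
proof (rule pres_eq_action[where V = valid and eqv = equ])
  show "valid ([], 0)" by (simp add: valid_def m_pos)
  show "equ r s" if "equ s r" for s r using that teq_sym by (simp add: equ_def)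
  show "equ s q" if "equ s r" "equ r q" for s r q
    using that teq_trans[of "fst s" "fst r" "fst q"] by (simp add: equ_def)
  show "equ s s" for s by (simp add: equ_def)
qed (rule valid_act equ_act act_inverse act_relator; assumption)+

lemma eqA_lift: "u \<simeq> v \<Longrightarrow> lift_word u \<cong> lift_word v"
proof (induction rule: pres_eq.induct)
  case (cancel u a w)
  show ?case using pres_eq.cancel[of G "lift_word u" "(Some (fst a), snd a)" "lift_word w"]
    by (simp add: inv_letter_def)
next
  case (relator r u w)
  then obtain x y where "r = commutator x y" "E x y" by (auto simp: raag_rels_def)
  then have "lift_word r \<in> G" by (auto simp: semidirect_rels_def lift_commutator[symmetric])
  then show ?case using pres_eq.relator[of "lift_word r" G "lift_word u" "lift_word w"] by simp
qed (auto intro: pres_eq.intros)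

lemma t_order: "replicate m t \<cong> []"
  using pres_eq.relator[of "replicate m t" G "[]" "[]"] by (simp add: semidirect_rels_def)

lemma t_mod: "replicate k t \<cong> replicate (k mod m) t"
proof -
  have "replicate (m * q) t \<cong> []" for q
  proof (induction q)
    case (Suc q)
    have "replicate m t @ replicate (m * q) t \<cong> [] @ []" by (rule pres_eq_append[OF t_order Suc])
    then show ?case by (simp add: replicate_add)
  qed (simp add: pres_eq.refl)
  then have "replicate (m * (k div m)) t @ replicate (k mod m) t \<cong> [] @ replicate (k mod m) t"
    by (rule pres_eq_append[OF _ pres_eq.refl])
  then show ?thesis by (simp add: replicate_add[symmetric])
qed

lemma t'_eq: "[t'] \<cong> replicate mp t"
proof -
  have "replicate mp t @ [t] \<cong> []"
    using t_order unfolding replicate_append_same replicate_Suc[symmetric] Suc_mp .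
  then have "replicate mp t \<cong> [] @ inv_word [t]" by (simp add: pres_eq_move_right)
  then show ?thesis by (simp add: inv_letter_def pres_eq.sym)
qed

text \<open>The relators treat positive generators. Inverting \<open>t' x t\<close> gives
  \<open>t' x^-1 t\<close>, so the same rule holds for negative ones.\<close>

lemma t'_lift: "word_over {..<n} w \<Longrightarrow> [t'] @ lift_word w \<cong> lift_word (map f w) @ [t']"
proof (induction w)
  case (Cons a w)
  have pos: "[t', (Some x, True), t] \<cong> lift_word [f (x, True)]" if "x < n" for x
  proof -
    have "[t', (Some x, True), t] @ inv_word (lift_word (phi x)) \<cong> []"
      using pres_eq.relator[of "[t', (Some x, True), t] @ inv_word (lift_word (phi x))" G "[]" "[]"] that
      by (auto simp: semidirect_rels_def)
    then have "[t', (Some x, True), t] \<cong> lift_word (phi x)"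
      by (subst (asm) pres_eq_move_right) simp
    also have "lift_word (phi x) \<cong> lift_word [f (x, True)]" by (rule eqA_lift[OF phi_f[OF that]])
    finally show ?thesis .
  qed
  have "[t', (Some (fst a), snd a), t] \<cong> lift_word [f a]"
  proof (cases "snd a")
    case True
    then show ?thesis using pos[of "fst a"] Cons.prems by (metis lessThan_iff prod.collapse word_over_simps(2))
  next
    case False
    then have a: "a = inv_letter (fst a, True)" by (simp add: inv_letter_def prod_eq_iff)
    have "inv_word [t', (Some (fst a), True), t] \<cong> inv_word (lift_word [f (fst a, True)])"
      using Cons.prems by (intro pres_eq_inv_word pos) simp
    moreover have "inv_word (lift_word [f (fst a, True)]) = lift_word [f a]"
    proof -
      have "f a = inv_letter (f (fst a, True))" by (subst a) (rule f_inv)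
      then show ?thesis by (simp add: inv_letter_def)
    qed
    ultimately show ?thesis using False by (simp add: inv_letter_def)
  qed
  then have "[t', (Some (fst a), snd a)] @ [t] \<cong> lift_word [f a]" by simp
  then have "[t', (Some (fst a), snd a)] \<cong> lift_word [f a] @ [t']"
    by (subst (asm) pres_eq_move_right) (simp add: inv_letter_def)
  then have "[t', (Some (fst a), snd a)] @ lift_word w \<cong> (lift_word [f a] @ [t']) @ lift_word w"
    by (rule pres_eq_append[OF _ pres_eq.refl])
  also have "(lift_word [f a] @ [t']) @ lift_word w \<cong> lift_word [f a] @ (lift_word (map f w) @ [t'])"
    using pres_eq_append[OF pres_eq.refl Cons.IH, of "lift_word [f a]"] Cons.prems by simp
  finally show ?case by simp
qed (simp add: pres_eq.refl)

lemma t_lift: assumes "word_over {..<n} w" shows "[t] @ lift_word w \<cong> lift_word (map fi w) @ [t]"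
proof -
  have "[t'] @ lift_word (map fi w) \<cong> lift_word (map f (map fi w)) @ [t']"
    using fi.word_over_map[OF assms] by (rule t'_lift)
  then have "lift_word (map fi w) \<cong> ([t] @ lift_word w) @ [t']"
    by (subst (asm) pres_eq_move_left) (simp add: inv_letter_def)
  then have "([t] @ lift_word w) @ [t'] \<cong> lift_word (map fi w)" by (rule pres_eq.sym)
  then show ?thesis by (subst (asm) pres_eq_move_right) (simp add: inv_letter_def)
qed

lemma t_pow_lift:
  "word_over {..<n} w \<Longrightarrow> replicate k t @ lift_word w \<cong> lift_word (map (fi ^^ k) w) @ replicate k t"
proof (induction k)
  case (Suc k)
  interpret fik: raag_symmetry n E "fi ^^ k" by (rule fi.raag_symmetry_funpow)
  have "[t] @ (replicate k t @ lift_word w) \<cong> [t] @ (lift_word (map (fi ^^ k) w) @ replicate k t)"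
    by (rule pres_eq_append[OF pres_eq.refl Suc.IH[OF Suc.prems]])
  also have "[t] @ (lift_word (map (fi ^^ k) w) @ replicate k t) \<cong>
      (lift_word (map fi (map (fi ^^ k) w)) @ [t]) @ replicate k t"
    using pres_eq_append[OF t_lift[OF fik.word_over_map[OF Suc.prems]] pres_eq.refl] by simp
  finally show ?case by (simp add: o_def)
qed (simp add: pres_eq.refl)

lemma semidirect_gens_simps [simp]:
  "None \<in> semidirect_gens n" "Some x \<in> semidirect_gens n \<longleftrightarrow> x < n"
  by (auto simp: semidirect_gens_def)

lemma word_over_lift [simp]: "word_over (semidirect_gens n) (lift_word w) \<longleftrightarrow> word_over {..<n} w"
  by (induction w) auto

lemma word_over_t [simp]: "word_over (semidirect_gens n) (replicate k t)"
  by (induction k) auto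

text \<open>The length estimate, needed to bound conjugators by the input lengths, holds because
  \<open>t\<close> and \<open>t'\<close> only permute letters and \<open>lmul\<close> adds at most
  one.\<close>

lemma ev_correct:
  assumes "word_over (semidirect_gens n) u"
  shows "word_over {..<n} (fst (ev u)) \<and> length (fst (ev u)) \<le> length u \<and> snd (ev u) < m
    \<and> u \<cong> lift_word (fst (ev u)) @ replicate (snd (ev u)) t"
  using assms
proof (induction u)
  case Nil
  show ?case by (simp add: ev_def m_pos pres_eq.refl)
next
  case (Cons a u)
  obtain w i where wi: "ev u = (w, i)" by fastforce
  from Cons have IH: "word_over {..<n} w" "length w \<le> length u" "i < m" "u \<cong> lift_word w @ replicate i t"
    by (auto simp: wi)
  have ev: "ev (a # u) = act a (w, i)" using wi by (simp add: ev_def)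
  have step: "[a] @ u \<cong> [a] @ (lift_word w @ replicate i t)"
    by (rule pres_eq_append[OF pres_eq.refl IH(4)])
  consider x e where "a = (Some x, e)" "x < n" | "a = t" | "a = t'"
    using Cons.prems by (cases a; cases "fst a"; cases "snd a") auto
  then show ?case
  proof cases
    case 1
    have "lift_word ((x, e) # w) \<cong> lift_word (lmul (x, e) w)"
      by (rule eqA_lift[OF pres_eq.sym[OF lmul_eqA]])
    then have "lift_word ((x, e) # w) @ replicate i t \<cong> lift_word (lmul (x, e) w) @ replicate i t"
      by (rule pres_eq_append[OF _ pres_eq.refl])
    then have "a # u \<cong> lift_word (lmul (x, e) w) @ replicate i t"
      using pres_eq.trans[OF step] by (simp add: 1)
    moreover have "word_over {..<n} (lmul (x, e) w)"
      by (rule word_over_subset[OF order_trans[OF set_lmul], of _ _ "(x, e) # w"]) (use IH 1 in auto)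
    moreover have "length (lmul (x, e) w) \<le> Suc (length w)"
      by (auto simp: lmul_def split: option.splits dest: length_remove_first)
    ultimately show ?thesis using IH unfolding ev by (simp add: 1)
  next
    case 2
    note step
    also have "[a] @ (lift_word w @ replicate i t) \<cong> (lift_word (map fi w) @ [t]) @ replicate i t"
      using pres_eq_append[OF t_lift[OF IH(1)] pres_eq.refl] by (simp add: 2)
    also have "(lift_word (map fi w) @ [t]) @ replicate i t = lift_word (map fi w) @ replicate (i + 1) t"
      by simp
    also have "lift_word (map fi w) @ replicate (i + 1) t \<cong> lift_word (map fi w) @ replicate ((i + 1) mod m) t"
      by (rule pres_eq_append[OF pres_eq.refl t_mod])
    finally show ?thesis using IH fi.word_over_map[OF IH(1)] m_pos unfolding ev by (simp add: 2)
  next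
    case 3
    note step
    also have "[a] @ (lift_word w @ replicate i t) \<cong> (lift_word (map f w) @ [t']) @ replicate i t"
      using pres_eq_append[OF t'_lift[OF IH(1)] pres_eq.refl] by (simp add: 3)
    also have "(lift_word (map f w) @ [t']) @ replicate i t \<cong>
        lift_word (map f w) @ (replicate mp t @ replicate i t)"
      using pres_eq_append[OF pres_eq.refl pres_eq_append[OF t'_eq pres_eq.refl]] by simp
    also have "replicate mp t @ replicate i t = replicate (i + mp) t"
      by (simp add: replicate_add[symmetric] add.commute)
    also have "lift_word (map f w) @ replicate (i + mp) t \<cong>
        lift_word (map f w) @ replicate ((i + mp) mod m) t"
      by (rule pres_eq_append[OF pres_eq.refl t_mod])
    finally show ?thesis using IH word_over_map[OF IH(1)] m_pos unfolding ev by (simp add: 3)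
  qed
qed

text \<open>Normal forms are unique up to commutations, but the empty trace has a single
  representative. The word problem thus becomes a literal equality test.\<close>

lemma ev_trivial_iff:
  assumes "word_over (semidirect_gens n) u" shows "ev u = ([], 0) \<longleftrightarrow> u \<cong> []"
proof
  assume "ev u = ([], 0)"
  then show "u \<cong> []" using ev_correct[OF assms] by simp
next
  assume "u \<cong> []"
  from ev_cong[OF this] show "ev u = ([], 0)"
    using teq_length[of "fst (ev u)" "[]"] by (auto simp: equ_def ev_def prod_eq_iff)
qed

lemma normal_form_mult:
  assumes "word_over {..<n} b"
    and "u \<cong> lift_word a @ replicate i t" "v \<cong> lift_word b @ replicate j t"
  shows "u @ v \<cong> lift_word (a @ map (fi ^^ i) b) @ replicate (i + j) t"
proof -
  have "u @ v \<cong> (lift_word a @ replicate i t) @ (lift_word b @ replicate j t)"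
    by (rule pres_eq_append[OF assms(2,3)])
  also have "(lift_word a @ replicate i t) @ (lift_word b @ replicate j t) \<cong>
      lift_word a @ (lift_word (map (fi ^^ i) b) @ replicate i t) @ replicate j t"
    using pres_eq_context[OF t_pow_lift[OF assms(1), of i], of "lift_word a" "replicate j t"] by simp
  finally show ?thesis by (simp add: replicate_add)
qed

lemma normal_form_unique:
  assumes "lift_word a @ replicate i t \<cong> lift_word b @ replicate j t"
  shows "a \<simeq> b" "i mod m = j mod m"
proof -
  have *: "ev (lift_word a @ replicate i t) = (red a, i mod m)" for a i
    unfolding ev_def foldr_append foldr_act_t[OF m_pos] by (simp add: foldr_act_lift red_def)
  from ev_cong[OF assms] have "red a \<sim> red b" "i mod m = j mod m" by (simp_all add: * equ_def)
  then show "a \<simeq> b" "i mod m = j mod m"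
    using pres_eq.trans[OF pres_eq.sym[OF red_eqA] pres_eq.trans[OF teq_imp_eqA red_eqA]] by blast+
qed

lemma conj_iff: "pres_eq S (w @ u @ inv_word w) v \<longleftrightarrow> pres_eq S (w @ u) (v @ w)"
  using pres_eq_move_right[of S "w @ u" "inv_word w" v] by simp

text \<open>A conjugator \<open>c t^k\<close> can be taken with \<open>k < m\<close>, which accounts
  for the summand \<open>m\<close>; only \<open>c\<close> has to be replaced by a short
  element.\<close>

theorem conjugate_words_iff:
  assumes u: "word_over (semidirect_gens n) u" and v: "word_over (semidirect_gens n) v"
  shows "conjugate_words G (semidirect_gens n) u v \<longleftrightarrow>
    (\<exists>w. word_over (semidirect_gens n) w \<and> length w \<le> conj_bound n (length u) (length v) + m
      \<and> ev (w @ u @ inv_word w @ inv_word v) = ([], 0))" (is "?L \<longleftrightarrow> (\<exists>w. ?Q w)")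
proof -
  have ev_iff: "ev (w @ u @ inv_word w @ inv_word v) = ([], 0) \<longleftrightarrow> w @ u \<cong> v @ w"
    if "word_over (semidirect_gens n) w" for w
    using ev_trivial_iff[of "w @ u @ inv_word w @ inv_word v"] that u v conj_iff[of G w u v]
      pres_eq_move_right[of G "w @ u @ inv_word w" "inv_word v" "[]"] by simp
  show ?thesis
  proof
    assume "\<exists>w. ?Q w"
    then show ?L unfolding conjugate_words_def using ev_iff conj_iff by blast
  next
    assume ?L
    then obtain w where w: "word_over (semidirect_gens n) w" "w @ u \<cong> v @ w"
      unfolding conjugate_words_def conj_iff by blast
    obtain c k where c: "word_over {..<n} c" "k < m" "w \<cong> lift_word c @ replicate k t"
      using ev_correct[OF w(1)] by blast
    obtain a i where a: "word_over {..<n} a" "length a \<le> length u" "u \<cong> lift_word a @ replicate i t"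
      using ev_correct[OF u] by blast
    obtain b j where b: "word_over {..<n} b" "length b \<le> length v" "v \<cong> lift_word b @ replicate j t"
      using ev_correct[OF v] by blast
    interpret fik: raag_symmetry n E "fi ^^ k" by (rule fi.raag_symmetry_funpow)
    interpret fij: raag_symmetry n E "fi ^^ j" by (rule fi.raag_symmetry_funpow)
    \<comment> \<open>Here \<open>w u = c fi^k(a) t^(k+i)\<close> and
      \<open>v w = b fi^j(c) t^(j+k)\<close>. The twist is \<open>fi^j\<close>, and the condition on
      exponents does not involve \<open>c\<close>, so it survives replacing \<open>c\<close> by
      \<open>d\<close>.\<close>
    let ?a = "map (fi ^^ k) a"
    have "lift_word (c @ ?a) @ replicate (k + i) t \<cong> w @ u"
      by (rule pres_eq.sym[OF normal_form_mult[OF a(1) c(3) a(3)]])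
    also note w(2)
    also have "v @ w \<cong> lift_word (b @ map (fi ^^ j) c) @ replicate (j + k) t"
      by (rule normal_form_mult[OF c(1) b(3) c(3)])
    finally have eq: "c @ ?a \<simeq> b @ map (fi ^^ j) c" "(k + i) mod m = (j + k) mod m"
      by (rule normal_form_unique)+
    obtain d where d: "word_over {..<n} d" "length d \<le> conj_bound n (length ?a) (length b)"
      "d @ ?a \<simeq> b @ map (fi ^^ j) d"
      using fij.twisted_conjugator_bound[OF fik.word_over_map[OF a(1)] b(1) c(1) eq(1)] by blast
    let ?w = "lift_word d @ replicate k t"
    have "?w @ u \<cong> lift_word (d @ ?a) @ replicate (k + i) t"
      by (rule normal_form_mult[OF a(1) pres_eq.refl a(3)])
    also have "lift_word (d @ ?a) @ replicate (k + i) t \<cong> lift_word (b @ map (fi ^^ j) d) @ replicate ((j + k) mod m) t"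
      using pres_eq_append[OF eqA_lift[OF d(3)] t_mod[of "k + i"]] eq(2) by simp
    also have "lift_word (b @ map (fi ^^ j) d) @ replicate ((j + k) mod m) t
        \<cong> lift_word (b @ map (fi ^^ j) d) @ replicate (j + k) t"
      by (rule pres_eq_append[OF pres_eq.refl pres_eq.sym[OF t_mod]])
    also have "lift_word (b @ map (fi ^^ j) d) @ replicate (j + k) t \<cong> v @ ?w"
      by (rule pres_eq.sym[OF normal_form_mult[OF d(1) b(3) pres_eq.refl]])
    finally have "?w @ u \<cong> v @ ?w" .
    moreover have "length ?w \<le> conj_bound n (length u) (length v) + m"
      using d(2) c(2) conj_bound_mono[OF a(2) b(2), of n] by simp
    moreover have over: "word_over (semidirect_gens n) ?w" using d(1) by simp
    ultimately show "\<exists>w. ?Q w" using ev_iff[OF over] by blast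
  qed
qed

end

section \<open>Computable functions\<close>

text \<open>Codes are chosen by type so that programs compose; on pairs of words they coincide with
  the encoding prescribed for inputs.\<close>

class encodable =
  fixes enc :: "'a \<Rightarrow> nat"
  assumes enc_inj: "enc x = enc y \<Longrightarrow> x = y"

lemma enc_eq_iff [simp]: "enc x = enc y \<longleftrightarrow> x = y"
  using enc_inj by blast

instantiation nat :: encodable
begin
definition enc_nat :: "nat \<Rightarrow> nat" where [simp]: "enc_nat x = x"
instance by standard simp
end

instantiation bool :: encodable
begin
definition enc_bool :: "bool \<Rightarrow> nat" where "enc_bool b = (if b then 1 else 0)"
instance by standard (auto simp: enc_bool_def split: if_splits)
end

instantiation prod :: (encodable, encodable) encodable
begin
definition enc_prod :: "'a \<times> 'b \<Rightarrow> nat" where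
  "enc_prod p = prod_encode (enc (fst p), enc (snd p))"
instance by standard (auto simp: enc_prod_def prod_eq_iff)
end

instantiation option :: (encodable) encodable
begin
definition enc_option :: "'a option \<Rightarrow> nat" where
  "enc_option x = (case x of None \<Rightarrow> 0 | Some y \<Rightarrow> Suc (enc y))"
instance by standard (auto simp: enc_option_def split: option.splits)
end

instantiation list :: (encodable) encodable
begin
definition enc_list :: "'a list \<Rightarrow> nat" where
  "enc_list xs = list_encode (map enc xs)"
instance
proof
  fix x y :: "'a list"
  assume "enc x = enc y"
  moreover have "inj (enc :: 'a \<Rightarrow> nat)" by (simp add: inj_def)
  ultimately show "x = y"
    unfolding enc_list_def by (metis injD inj_list_encode inj_map_eq_map)
qed
end

definition computable :: "('a::encodable \<Rightarrow> 'b::encodable) \<Rightarrow> bool" where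
  "computable f \<longleftrightarrow> (\<exists>r. \<forall>x. eval_recf r [enc x] (enc (f x)))"

lemma eval_comp1: "eval_recf g xs y \<Longrightarrow> eval_recf f [y] z \<Longrightarrow> eval_recf (Comp f [g]) xs z"
  by (rule eval_recf.comp[where ys = "[y]"]) auto

lemma eval_comp2:
  "eval_recf g xs y \<Longrightarrow> eval_recf h xs y' \<Longrightarrow> eval_recf f [y, y'] z \<Longrightarrow> eval_recf (Comp f [g, h]) xs z"
  by (rule eval_recf.comp[where ys = "[y, y']"]) auto

lemma eval_comp3:
  "eval_recf g xs y \<Longrightarrow> eval_recf h xs y' \<Longrightarrow> eval_recf i xs y'' \<Longrightarrow> eval_recf f [y, y', y''] z
    \<Longrightarrow> eval_recf (Comp f [g, h, i]) xs z"
  by (rule eval_recf.comp[where ys = "[y, y', y'']"]) auto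

lemma eval_proj0: "eval_recf (Proj 0) (x # xs) x"
  using eval_recf.proj[of 0 "x # xs"] by simp

lemma eval_proj1: "eval_recf (Proj 1) (x # y # xs) y"
  using eval_recf.proj[of 1 "x # y # xs"] by simp

lemma eval_proj2: "eval_recf (Proj 2) (x # y # z # xs) z"
  using eval_recf.proj[of 2 "x # y # z # xs"] by simp

lemmas eval_intros = eval_comp1 eval_comp2 eval_comp3 eval_proj0 eval_proj1 eval_proj2
  eval_recf.zero eval_recf.succ

section \<open>Arithmetic and Cantor pairing as recursive functions\<close>

definition r_const :: "nat \<Rightarrow> recf" where
  "r_const k = ((\<lambda>f. Comp Succ [f]) ^^ k) Zero"

lemma eval_const: "eval_recf (r_const k) xs k"
  unfolding r_const_def by (induction k) (auto intro: eval_intros)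

definition r_add :: recf where
  "r_add = Prim (Proj 0) (Comp Succ [Proj 0])"

lemma eval_add: "eval_recf r_add [a, b] (a + b)"
  unfolding r_add_def
  by (induction a) (auto intro!: eval_intros eval_recf.prim0 intro: eval_recf.primS)

text \<open>The step function receives \<open>y # k # xs\<close>, whose entry 1 is the predecessor
  \<open>k\<close>.\<close>

definition r_pred :: recf where
  "r_pred = Prim Zero (Proj 1)"

lemma eval_pred: "eval_recf r_pred [a] (a - 1)"
  unfolding r_pred_def
proof (induction a)
  case 0 then show ?case by (auto intro!: eval_intros eval_recf.prim0)
next
  case (Suc a)
  then show ?case using eval_recf.primS[OF Suc eval_proj1] by simp
qed

text \<open>Recursion runs over the first argument, so the subtrahend comes first.\<close>

definition r_sub :: recf where
  "r_sub = Prim (Proj 0) (Comp r_pred [Proj 0])"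

lemma eval_sub: "eval_recf r_sub [a, b] (b - a)"
  unfolding r_sub_def
proof (induction a)
  case 0 then show ?case by (auto intro!: eval_intros eval_recf.prim0)
next
  case (Suc a)
  have "eval_recf (Comp r_pred [Proj 0]) [b - a, a, b] (b - Suc a)"
    using eval_comp1[OF eval_proj0 eval_pred, of "b - a"] by simp
  with Suc show ?case by (auto intro: eval_recf.primS)
qed

definition r_triangle :: recf where
  "r_triangle = Prim Zero (Comp r_add [Proj 0, Comp Succ [Proj 1]])"

lemma eval_triangle: "eval_recf r_triangle [a] (triangle a)"
  unfolding r_triangle_def
proof (induction a)
  case 0 then show ?case by (auto intro!: eval_intros eval_recf.prim0)
next
  case (Suc a)
  have "eval_recf (Comp r_add [Proj 0, Comp Succ [Proj 1]]) [triangle a, a] (triangle a + Suc a)"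
    by (rule eval_intros eval_add)+
  with Suc show ?case using eval_recf.primS by fastforce
qed

definition r_pair :: recf where
  "r_pair = Comp r_add [Comp r_triangle [r_add], Proj 0]"

lemma eval_pair: "eval_recf r_pair [a, b] (prod_encode (a, b))"
  unfolding r_pair_def prod_encode_def prod.case by (rule eval_intros eval_add eval_triangle)+

text \<open>The row of the Cantor pairing in which a code lies is found by unbounded search.\<close>

definition r_row :: recf where
  "r_row = Mu (Comp r_sub [Comp r_triangle [Comp Succ [Proj 0]], Comp Succ [Proj 1]])"

lemma triangle_mono: "a \<le> b \<Longrightarrow> triangle a \<le> triangle b"
  by (induction b rule: dec_induct) auto

text \<open>The code \<open>z\<close> lies below \<open>triangle (Suc s)\<close> exactly from row
  \<open>s = a + b\<close> on, and this is when the truncated difference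
  \<open>Suc z - triangle (Suc s)\<close> vanishes.\<close>

lemma eval_row: "eval_recf r_row [prod_encode (a, b)] (a + b)"
proof -
  let ?z = "prod_encode (a, b)"
  let ?f = "Comp r_sub [Comp r_triangle [Comp Succ [Proj 0]], Comp Succ [Proj 1]]"
  have f: "eval_recf ?f [s, ?z] (Suc ?z - triangle (Suc s))" for s
    by (rule eval_intros eval_sub eval_triangle)+
  have "eval_recf ?f [a + b, ?z] 0"
    using f[of "a + b"] by (simp add: prod_encode_def)
  moreover have "Suc ?z - triangle (Suc s) \<noteq> 0" if "s < a + b" for s
  proof -
    have "triangle (Suc s) \<le> triangle (a + b)" using that by (intro triangle_mono) simp
    then show ?thesis by (simp add: prod_encode_def)
  qed
  ultimately show ?thesis
    unfolding r_row_def using f by (intro eval_recf.mu) blast+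
qed

definition r_fst :: recf where
  "r_fst = Comp r_sub [Comp r_triangle [r_row], Proj 0]"

lemma eval_fst: "eval_recf r_fst [prod_encode (a, b)] a"
proof -
  have "eval_recf r_fst [prod_encode (a, b)] (prod_encode (a, b) - triangle (a + b))"
    unfolding r_fst_def by (rule eval_intros eval_sub eval_triangle eval_row)+
  then show ?thesis by (simp add: prod_encode_def)
qed

definition r_snd :: recf where
  "r_snd = Comp r_sub [r_fst, r_row]"

lemma eval_snd: "eval_recf r_snd [prod_encode (a, b)] b"
proof -
  have "eval_recf r_snd [prod_encode (a, b)] (a + b - a)"
    unfolding r_snd_def by (rule eval_intros eval_sub eval_fst eval_row)+
  then show ?thesis by simp
qed

section \<open>Closure properties of computable functions\<close>

named_theorems comp_intros

lemma computableI: "(\<And>x. eval_recf r [enc x] (enc (f x))) \<Longrightarrow> computable f"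
  unfolding computable_def by blast

lemma computable_comp:
  assumes "computable f" "computable g" shows "computable (\<lambda>x. f (g x))"
proof -
  obtain r s where "\<And>x. eval_recf r [enc x] (enc (f x))" "\<And>x. eval_recf s [enc x] (enc (g x))"
    using assms unfolding computable_def by blast
  then show ?thesis by (intro computableI[of "Comp r [s]"]) (rule eval_comp1)
qed

lemma computable_id [comp_intros]: "computable (\<lambda>x. x)"
  by (rule computableI) (rule eval_proj0)

lemma computable_const [comp_intros]: "computable (\<lambda>x. c)"
  by (rule computableI) (rule eval_const)

lemma computable_Pair [comp_intros]:
  assumes "computable f" "computable g" shows "computable (\<lambda>x. (f x, g x))"
proof -
  obtain r s where "\<And>x. eval_recf r [enc x] (enc (f x))" "\<And>x. eval_recf s [enc x] (enc (g x))"
    using assms unfolding computable_def by blast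
  then show ?thesis
    by (intro computableI[of "Comp r_pair [r, s]"])
      (auto simp: enc_prod_def intro!: eval_comp2 eval_pair)
qed

lemma computable_fst [comp_intros]: "computable f \<Longrightarrow> computable (\<lambda>x. fst (f x))"
  by (rule computable_comp[of fst]) (auto intro: computableI[of r_fst] simp: enc_prod_def eval_fst)

lemma computable_snd [comp_intros]: "computable f \<Longrightarrow> computable (\<lambda>x. snd (f x))"
  by (rule computable_comp[of snd]) (auto intro: computableI[of r_snd] simp: enc_prod_def eval_snd)

lemma computable_Suc [comp_intros]: "computable f \<Longrightarrow> computable (\<lambda>x. Suc (f x))"
  by (rule computable_comp[of Suc], rule computableI[of Succ])
    (simp_all add: enc_nat_def eval_recf.succ)

lemma computable_Some [comp_intros]: "computable f \<Longrightarrow> computable (\<lambda>x. Some (f x))"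
  by (rule computable_comp[of Some], rule computableI[of Succ])
    (simp_all add: enc_option_def eval_recf.succ)

lemma computable_Cons [comp_intros]:
  assumes "computable f" "computable g" shows "computable (\<lambda>x. f x # g x)"
proof -
  obtain r where r: "\<And>x. eval_recf r [enc x] (enc (f x, g x))"
    using computable_Pair[OF assms] unfolding computable_def by blast
  have "eval_recf (Comp Succ [r]) [enc x] (Suc (enc (f x, g x)))" for x
    by (rule eval_intros r)+
  moreover have "Suc (enc (f x, g x)) = enc (f x # g x)" for x
    by (simp add: enc_list_def enc_prod_def)
  ultimately show ?thesis by (intro computableI) (simp only:)
qed

lemma computable_enc [comp_intros]: "computable f \<Longrightarrow> computable (\<lambda>x. enc (f x))"
  unfolding computable_def by simp

text \<open>Iteration on encoded states of any type; the later schemes for recursion over numbers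
  and lists reduce to it.\<close>

lemma computable_funpow [comp_intros]:
  fixes f :: "'a::encodable \<Rightarrow> 'a" and h :: "'b::encodable \<Rightarrow> 'a"
  assumes "computable f" "computable k" "computable h"
  shows "computable (\<lambda>x. (f ^^ k x) (h x))"
proof -
  obtain rf where f: "\<And>x. eval_recf rf [enc x] (enc (f x))"
    using assms unfolding computable_def by blast
  obtain rk where k: "\<And>x. eval_recf rk [enc x] (k x)"
    using assms unfolding computable_def by auto
  obtain rh where h: "\<And>x. eval_recf rh [enc x] (enc (h x))"
    using assms unfolding computable_def by blast
  have "eval_recf (Prim (Proj 0) (Comp rf [Proj 0])) [j, enc a] (enc ((f ^^ j) a))" for j and a :: 'a
    by (induction j) (auto intro!: eval_recf.prim0 eval_intros f intro: eval_recf.primS)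
  then show ?thesis
    by (intro computableI[of "Comp (Prim (Proj 0) (Comp rf [Proj 0])) [rk, rh]"])
      (rule eval_comp2[OF k h])
qed

text \<open>Only the branch selected by the test may be evaluated: codes of \<open>Nil\<close> and \<open>None\<close> have
  no predecessor that encodes a value of the required type.\<close>

lemma computable_case_code:
  assumes "computable (h :: 'a::encodable \<Rightarrow> nat)"
    and "\<And>x. h x = 0 \<Longrightarrow> eval_recf rz [enc x] (enc (f x))"
    and "\<And>x c. h x = Suc c \<Longrightarrow> eval_recf rs [prod_encode (enc x, c)] (enc (f x))"
    and "\<And>x. h x \<noteq> 0 \<Longrightarrow> \<exists>z. eval_recf rz [enc x] z"
  shows "computable f"
proof -
  obtain rh where h: "\<And>x. eval_recf rh [enc x] (h x)"
    using assms(1) unfolding computable_def by auto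
  let ?P = "Prim rz (Comp rs [Comp r_pair [Proj 2, Comp r_pred [Comp rh [Proj 2]]]])"
  \<comment> \<open>The sign of \<open>h x\<close>, used as recursion counter: 0 runs
    \<open>rz\<close>, 1 runs \<open>rs\<close> after it. In the second case the result of
    \<open>rz\<close> is discarded but must exist.\<close>
  let ?s = "Comp r_sub [Comp r_sub [rh, r_const 1], r_const 1]"
  have s: "eval_recf ?s [enc x] (1 - (1 - h x))" for x
    by (rule eval_intros eval_sub eval_const h)+
  have "eval_recf ?P [1 - (1 - h x), enc x] (enc (f x))" for x
  proof (cases "h x")
    case 0
    then show ?thesis using assms(2) by (auto intro: eval_recf.prim0)
  next
    case (Suc c)
    obtain z where z: "eval_recf rz [enc x] z" using assms(4)[of x] Suc by auto
    have "eval_recf (Comp r_pair [Proj 2, Comp r_pred [Comp rh [Proj 2]]]) [z, 0, enc x]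
        (prod_encode (enc x, h x - 1))"
      by (rule eval_intros eval_pair eval_pred h)+
    then have "eval_recf (Comp rs [Comp r_pair [Proj 2, Comp r_pred [Comp rh [Proj 2]]]])
        [z, 0, enc x] (enc (f x))"
      using assms(3)[OF Suc] Suc by (intro eval_comp1) auto
    then show ?thesis using Suc z by (auto intro: eval_recf.primS eval_recf.prim0)
  qed
  then show ?thesis
    by (intro computableI[of "Comp ?P [?s, Proj 0]"]) (rule eval_comp2[OF s eval_proj0])
qed

lemma computable_case_list:
  assumes "computable l" "computable a" "computable (\<lambda>p. b (fst p) (fst (snd p)) (snd (snd p)))"
  shows "computable (\<lambda>x. case l x of [] \<Rightarrow> a x | y # ys \<Rightarrow> b x y ys)"
proof -
  obtain ra rb where a: "\<And>x. eval_recf ra [enc x] (enc (a x))"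
    and b: "\<And>p. eval_recf rb [enc p] (enc (b (fst p) (fst (snd p)) (snd (snd p))))"
    using assms unfolding computable_def by blast
  show ?thesis
  proof (rule computable_case_code[where h = "\<lambda>x. enc (l x)" and rz = ra and rs = rb])
    show "computable (\<lambda>x. enc (l x))" by (intro comp_intros assms)
    show "eval_recf ra [enc x] (enc (case l x of [] \<Rightarrow> a x | y # ys \<Rightarrow> b x y ys))"
      if "enc (l x) = 0" for x
      using that a by (cases "l x") (auto simp: enc_list_def)
    show "eval_recf rb [prod_encode (enc x, c)] (enc (case l x of [] \<Rightarrow> a x | y # ys \<Rightarrow> b x y ys))"
      if "enc (l x) = Suc c" for x c
    proof (cases "l x")
      case Nil then show ?thesis using that by (simp add: enc_list_def)
    next
      case (Cons y ys)
      then have "prod_encode (enc x, c) = enc (x, y, ys)"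
        using that by (auto simp: enc_list_def enc_prod_def)
      then show ?thesis using b[of "(x, y, ys)"] Cons by simp
    qed
    show "\<exists>z. eval_recf ra [enc x] z" if "enc (l x) \<noteq> 0" for x using a by blast
  qed
qed

lemma computable_case_option:
  assumes "computable l" "computable a" "computable (\<lambda>p. b (fst p) (snd p))"
  shows "computable (\<lambda>x. case l x of None \<Rightarrow> a x | Some y \<Rightarrow> b x y)"
proof -
  obtain ra rb where a: "\<And>x. eval_recf ra [enc x] (enc (a x))"
    and b: "\<And>p. eval_recf rb [enc p] (enc (b (fst p) (snd p)))"
    using assms unfolding computable_def by blast
  show ?thesis
  proof (rule computable_case_code[where h = "\<lambda>x. enc (l x)" and rz = ra and rs = rb])
    show "computable (\<lambda>x. enc (l x))" by (intro comp_intros assms)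
    show "eval_recf ra [enc x] (enc (case l x of None \<Rightarrow> a x | Some y \<Rightarrow> b x y))"
      if "enc (l x) = 0" for x
      using that a by (cases "l x") (auto simp: enc_option_def)
    show "eval_recf rb [prod_encode (enc x, c)] (enc (case l x of None \<Rightarrow> a x | Some y \<Rightarrow> b x y))"
      if "enc (l x) = Suc c" for x c
    proof (cases "l x")
      case None then show ?thesis using that by (simp add: enc_option_def)
    next
      case (Some y)
      then have "prod_encode (enc x, c) = enc (x, y)"
        using that by (auto simp: enc_option_def enc_prod_def)
      then show ?thesis using b[of "(x, y)"] Some by simp
    qed
    show "\<exists>z. eval_recf ra [enc x] z" if "enc (l x) \<noteq> 0" for x using a by blast
  qed
qed

lemma computable_if [comp_intros]:
  assumes "computable c" "computable a" "computable b"
  shows "computable (\<lambda>x. if c x then a x else b x)"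
proof -
  obtain ra rb where a: "\<And>x. eval_recf ra [enc x] (enc (a x))"
    and b: "\<And>x. eval_recf rb [enc x] (enc (b x))"
    using assms unfolding computable_def by blast
  show ?thesis
  proof (rule computable_case_code[where h = "\<lambda>x. enc (c x)" and rz = rb and rs = "Comp ra [r_fst]"])
    show "computable (\<lambda>x. enc (c x))" by (intro comp_intros assms)
    show "eval_recf rb [enc x] (enc (if c x then a x else b x))" if "enc (c x) = 0" for x
      using that b by (auto simp: enc_bool_def split: if_splits)
    show "eval_recf (Comp ra [r_fst]) [prod_encode (enc x, d)] (enc (if c x then a x else b x))"
      if "enc (c x) = Suc d" for x d
    proof -
      have "c x" using that by (auto simp: enc_bool_def split: if_splits)
      moreover have "eval_recf (Comp ra [r_fst]) [prod_encode (enc x, d)] (enc (a x))"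
        by (rule eval_intros eval_fst a)+
      ultimately show ?thesis by simp
    qed
    show "\<exists>z. eval_recf rb [enc x] z" if "enc (c x) \<noteq> 0" for x using b by blast
  qed
qed

lemma computable_eq [comp_intros]:
  assumes "computable f" "computable g" shows "computable (\<lambda>x. f x = g x)"
proof -
  obtain r s where r: "\<And>x. eval_recf r [enc x] (enc (f x))" and s: "\<And>x. eval_recf s [enc x] (enc (g x))"
    using assms unfolding computable_def by blast
  \<comment> \<open>Codes are equal iff both truncated differences vanish, and codes are injective;
    \<open>r_sub\<close> takes the subtrahend first.\<close>
  let ?t = "Comp r_sub [Comp r_sub [s, r], Comp r_sub [Comp r_sub [r, s], r_const 1]]"
  have "eval_recf ?t [enc x] ((1 - (enc (g x) - enc (f x))) - (enc (f x) - enc (g x)))" for x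
    by (rule eval_intros eval_sub eval_const r s)+
  moreover have "(1 - (enc (g x) - enc (f x))) - (enc (f x) - enc (g x)) = enc (f x = g x)" for x
    using enc_eq_iff[of "f x" "g x"] unfolding enc_bool_def by (cases "f x = g x") (auto simp del: enc_eq_iff)
  ultimately show ?thesis by (intro computableI) (simp only:)
qed

text \<open>Iterating on pairs keeps the parameter \<open>x\<close> available at each step. Stating
  \<open>F\<close> by its recursion equations lets the scheme apply to existing functions.\<close>

lemma computable_nat_rec:
  assumes "computable i" "computable f"
    and "\<And>x. F x 0 = i x" "\<And>x k. F x (Suc k) = f (x, F x k)"
    and "computable g" "computable h"
  shows "computable (\<lambda>x. F (g x) (h x))"
proof -
  have "((\<lambda>p. (fst p, f p)) ^^ k) (x, i x) = (x, F x k)" for x k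
    by (induction k) (auto simp: assms)
  moreover have "computable (\<lambda>x. snd (((\<lambda>p. (fst p, f p)) ^^ h x) (g x, i (g x))))"
    by (intro comp_intros assms computable_comp[OF assms(1)])
  ultimately show ?thesis by simp
qed

lemma length_le_enc: "length xs \<le> enc xs"
  unfolding enc_list_def
proof (induction xs)
  case (Cons x xs)
  have "list_encode (map enc xs) \<le> prod_encode (enc x, list_encode (map enc xs))"
    by (rule le_prod_encode_2)
  with Cons show ?case by simp
qed simp

text \<open>The code of the list serves as number of iterations: it bounds the length, and surplus
  steps are idle on the empty list.\<close>

lemma computable_foldl:
  fixes l :: "'c::encodable \<Rightarrow> 'b::encodable list"
  assumes "computable f" "computable i" "computable l"
  shows "computable (\<lambda>x. foldl (\<lambda>a y. f (x, a, y)) (i x) (l x))"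
proof -
  define s where "s = (\<lambda>p. case snd (snd p) of [] \<Rightarrow> p
      | y # ys \<Rightarrow> (fst p, f (fst p, fst (snd p), y), ys))"
  have s: "computable s" unfolding s_def
    by (intro computable_case_list comp_intros computable_comp[OF assms(1)])
  have s_simps: "s (x, a, []) = (x, a, [])" "s (x, a, y # ys) = (x, f (x, a, y), ys)" for x a y ys
    by (simp_all add: s_def)
  have it: "length l \<le> k \<Longrightarrow> (s ^^ k) (x, a, l) = (x, foldl (\<lambda>a y. f (x, a, y)) a l, [])" for x a l k
  proof (induction k arbitrary: a l)
    case (Suc k)
    then show ?case by (cases l) (auto simp: funpow_Suc_right s_simps simp del: funpow.simps)
  qed simp
  have "computable (\<lambda>x. fst (snd ((s ^^ enc (l x)) (x, i x, l x))))"
    by (intro comp_intros s assms)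
  then show ?thesis by (simp add: it length_le_enc)
qed

lemma computable_rev [comp_intros]:
  assumes "computable l" shows "computable (\<lambda>x. rev (l x))"
proof -
  have *: "foldl (\<lambda>a y. y # a) as l = rev l @ as" for as l :: "'b list"
    by (induction l arbitrary: as) auto
  have "computable (\<lambda>x. foldl (\<lambda>a y. (\<lambda>p. snd (snd p) # fst (snd p)) (x, a, y)) [] (l x))"
    by (rule computable_foldl) (intro comp_intros assms)+
  then show ?thesis by (simp add: *)
qed

text \<open>Folding over the reversed list rebuilds the tail next to the value, so the step function
  has access to \<open>ys\<close>.\<close>

lemma computable_list_rec:
  assumes "computable i" "computable f"
    and F: "\<And>x. F x [] = i x" "\<And>x y ys. F x (y # ys) = f (x, y, ys, F x ys)"
    and "computable g" "computable l"
  shows "computable (\<lambda>x. F (g x) (l x))"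
proof -
  let ?step = "\<lambda>p. (snd (snd p) # fst (fst (snd p)),
      f (g (fst p), snd (snd p), fst (fst (snd p)), snd (fst (snd p))))"
  have "foldl (\<lambda>a y. ?step (x, a, y)) ([], i (g x)) (rev l) = (l, F (g x) l)" for x l
    by (induction l) (auto simp: F)
  moreover have "computable (\<lambda>x. snd (foldl (\<lambda>a y. ?step (x, a, y)) ([], i (g x)) (rev (l x))))"
    by (intro computable_snd computable_foldl; intro comp_intros assms computable_comp[OF assms(1)]
        computable_comp[OF assms(2)] computable_comp[OF assms(5)])
  ultimately show ?thesis by simp
qed

lemma computable_append [comp_intros]:
  assumes "computable f" "computable g" shows "computable (\<lambda>x. f x @ g x)"
proof -
  have "computable (\<lambda>x. (\<lambda>as bs. bs @ as) (g x) (f x))"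
    by (rule computable_list_rec[where i = "\<lambda>x. x" and f = "\<lambda>p. fst (snd p) # snd (snd (snd p))"])
      (auto intro!: comp_intros assms)
  then show ?thesis by simp
qed

lemma computable_concat [comp_intros]:
  assumes "computable f" shows "computable (\<lambda>x. concat (f x))"
  by (rule computable_list_rec[where F = "\<lambda>x. concat" and i = "\<lambda>x. []"
        and f = "\<lambda>p. fst (snd p) @ snd (snd (snd p))" and g = f])
    (auto intro!: comp_intros assms)

lemma computable_map [comp_intros]:
  assumes "computable (\<lambda>p. f (fst p) (snd p))" "computable l"
  shows "computable (\<lambda>x. map (f x) (l x))"
  by (rule computable_list_rec[where F = "\<lambda>x. map (f x)" and i = "\<lambda>x. []"
        and f = "\<lambda>p. f (fst p) (fst (snd p)) # snd (snd (snd p))" and g = "\<lambda>x. x"])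
    (auto intro!: comp_intros assms computable_comp[OF assms(1), of "\<lambda>p. (fst p, fst (snd p))", simplified])

lemma computable_list_ex:
  assumes "computable (\<lambda>p. f (fst p) (snd p))" "computable l"
  shows "computable (\<lambda>x. list_ex (f x) (l x))"
proof (rule computable_list_rec[where F = "\<lambda>x. list_ex (f x)" and i = "\<lambda>x. False"
        and f = "\<lambda>p. if f (fst p) (fst (snd p)) then True else snd (snd (snd p))" and g = "\<lambda>x. x"])
  show "computable (\<lambda>p. if f (fst p) (fst (snd p)) then True else snd (snd (snd p)))"
    by (intro comp_intros computable_comp[OF assms(1), of "\<lambda>p. (fst p, fst (snd p))", simplified])
qed (auto intro!: comp_intros assms)

lemma computable_foldr:
  assumes "computable (\<lambda>p. f (fst p) (snd p))" "computable l" "computable i"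
  shows "computable (\<lambda>x. foldr f (l x) (i x))"
proof -
  have "computable (\<lambda>x. (\<lambda>a l. foldr f l a) (i x) (l x))"
    by (rule computable_list_rec[where i = "\<lambda>x. x"
        and f = "\<lambda>p. f (fst (snd p)) (snd (snd (snd p)))"])
    (auto intro!: comp_intros assms computable_comp[OF assms(1), of "\<lambda>p. (fst (snd p), snd (snd (snd p)))", simplified])
  then show ?thesis by simp
qed

lemma computable_length [comp_intros]:
  assumes "computable f" shows "computable (\<lambda>x. length (f x))"
  by (rule computable_list_rec[where F = "\<lambda>x. length" and i = "\<lambda>x. 0"
        and f = "\<lambda>p. Suc (snd (snd (snd p)))" and g = f])
    (auto intro!: comp_intros assms)

lemma computable_add [comp_intros]:
  assumes "computable f" "computable g" shows "computable (\<lambda>x. f x + g x :: nat)"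
  by (rule computable_nat_rec[where F = "(+)" and i = "\<lambda>x. x" and f = "\<lambda>p. Suc (snd p)"])
    (auto intro!: comp_intros assms)

lemma computable_mult [comp_intros]:
  assumes "computable f" "computable g" shows "computable (\<lambda>x. f x * g x :: nat)"
  by (rule computable_nat_rec[where F = "(*)" and i = "\<lambda>x. 0" and f = "\<lambda>p. fst p + snd p"])
    (auto intro!: comp_intros assms)

lemma computable_power [comp_intros]:
  assumes "computable f" "computable g" shows "computable (\<lambda>x. f x ^ g x :: nat)"
  by (rule computable_nat_rec[where F = "(^)" and i = "\<lambda>x. 1" and f = "\<lambda>p. fst p * snd p"])
    (auto intro!: comp_intros assms)

text \<open>The points where \<open>f\<close> and \<open>g\<close> differ are patched one at a time.
  The fixed graph and letter permutation enter the algorithm as such finite tables.\<close>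

lemma computable_finite_support:
  assumes "finite {x. f x \<noteq> g x}" "computable g" shows "computable f"
proof -
  have "computable f" if "finite S" "\<And>x. x \<notin> S \<Longrightarrow> f x = g x" for f :: "'a \<Rightarrow> 'b" and S
    using that
  proof (induction S arbitrary: f rule: finite_induct)
    case empty
    then have "f = g" by auto
    then show ?case using assms(2) by simp
  next
    case (insert a S)
    have "computable (f(a := g a))" by (rule insert.IH) (use insert.prems in auto)
    then have "computable (\<lambda>x. if x = a then f a else (f(a := g a)) x)"
      by (intro computable_if comp_intros)
    moreover have "(\<lambda>x. if x = a then f a else (f(a := g a)) x) = f" by auto
    ultimately show ?case by simp
  qed
  from this[OF assms(1)] show ?thesis by auto
qed

fun words_upto :: "'a list \<Rightarrow> nat \<Rightarrow> 'a list list" where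
  "words_upto X 0 = [[]]"
| "words_upto X (Suc k) = [] # concat (map (\<lambda>a. map ((#) a) (words_upto X k)) X)"

lemma set_words_upto: "set (words_upto X k) = {w. set w \<subseteq> set X \<and> length w \<le> k}"
proof (induction k)
  case (Suc k)
  have "w \<in> set (words_upto X (Suc k)) \<longleftrightarrow> set w \<subseteq> set X \<and> length w \<le> Suc k" for w
    using Suc by (cases w) auto
  then show ?case by blast
qed auto

lemma computable_words_upto:
  assumes "computable k" shows "computable (\<lambda>x. words_upto X (k x))"
proof -
  have m: "computable (\<lambda>q. map ((#) (snd q)) (snd (fst q)))"
    by (intro comp_intros)
  show ?thesis
    by (rule computable_nat_rec[where F = "\<lambda>x. words_upto X" and i = "\<lambda>x. [[]]" and g = "\<lambda>x. x"
          and f = "\<lambda>p. [] # concat (map (\<lambda>a. map ((#) a) (snd p)) X)"])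
      (auto intro!: comp_intros assms m)
qed

lemma computable_inv_letter [comp_intros]:
  assumes "computable f" shows "computable (\<lambda>x. inv_letter (f x))"
proof -
  have eq: "inv_letter = (\<lambda>a. (fst a, if snd a = True then False else True))"
    by (auto simp: inv_letter_def)
  show ?thesis unfolding eq by (intro comp_intros assms)
qed

lemma computable_inv_word [comp_intros]:
  assumes "computable u" shows "computable (\<lambda>x. inv_word (u x))"
  unfolding inv_word_def by (intro comp_intros assms)

lemma computable_mod: assumes "computable f" shows "computable (\<lambda>x. f x mod c :: nat)"
  by (rule computable_nat_rec[where F = "\<lambda>x k. k mod c" and i = "\<lambda>x. 0" and g = "\<lambda>x. x"
        and f = "\<lambda>p. if Suc (snd p) = c then 0 else Suc (snd p)"])
    (auto simp: mod_Suc intro!: comp_intros assms)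

section \<open>The decision procedure\<close>

context raag_semidirect
begin

lemma computable_ind: "computable (\<lambda>p. ind (fst p) (snd p))"
proof -
  have "computable (\<lambda>p. E (fst p) (snd p))"
  proof (rule computable_finite_support[where g = "\<lambda>_. False"])
    have "{p. E (fst p) (snd p) \<noteq> False} \<subseteq> {..<n} \<times> {..<n}"
      using graph by (auto simp: simple_graph_def)
    then show "finite {p. E (fst p) (snd p) \<noteq> False}" by (rule finite_subset) simp
  qed (rule comp_intros)
  then have "computable (\<lambda>p. (\<lambda>p. E (fst p) (snd p)) (fst (fst p), fst (snd p)))"
    by (rule computable_comp) (intro comp_intros)
  then show ?thesis by (simp add: ind_def)
qed

lemma computable_remove_first: "computable (\<lambda>x. remove_first (fst x) (snd x))"
proof -
  have opt: "computable (\<lambda>p. case l p of None \<Rightarrow> None | Some w \<Rightarrow> Some (h p # w))"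
    if "computable l" "computable h" for l :: "'c::encodable \<Rightarrow> nat letter list option" and h
    by (intro computable_case_option comp_intros that computable_comp[OF that(2)])
  show ?thesis
    by (rule computable_list_rec[where F = remove_first and i = "\<lambda>_. None"
        and f = "\<lambda>p. if fst (snd p) = fst p then Some (fst (snd (snd p)))
          else if ind (fst p) (fst (snd p))
            then (case snd (snd (snd p)) of None \<Rightarrow> None | Some w \<Rightarrow> Some (fst (snd p) # w)) else None"])
      (auto intro!: comp_intros opt computable_comp[OF computable_ind, of "\<lambda>p. (fst p, fst (snd p))", simplified]
        simp: map_option_case split: option.split)
qed

lemma computable_lmul: "computable (\<lambda>x. lmul (fst x) (snd x))"
proof -
  have "computable (\<lambda>x. case remove_first (inv_letter (fst x)) (snd x) of None \<Rightarrow> fst x # snd x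
      | Some w \<Rightarrow> w)"
    by (rule computable_case_option; intro comp_intros
        computable_comp[OF computable_remove_first, of "\<lambda>x. (inv_letter (fst x), snd x)", simplified])
  then show ?thesis by (simp add: lmul_def)
qed

text \<open>By \<open>f_fix\<close>, both \<open>f\<close> and its power \<open>fi\<close> are
  finite modifications of the identity.\<close>

lemma computable_act:
  assumes f_fix: "\<And>a. \<not> fst a < n \<Longrightarrow> f a = a"
  shows "computable (\<lambda>x. act (fst x) (snd x))"
proof -
  have fin: "computable g" if "\<And>a. \<not> fst a < n \<Longrightarrow> g a = a" for g :: "nat letter \<Rightarrow> nat letter"
  proof (rule computable_finite_support[where g = "\<lambda>a. a"])
    have "{a. g a \<noteq> a} \<subseteq> {..<n} \<times> UNIV" using that by force
    then show "finite {a. g a \<noteq> a}" by (rule finite_subset) simp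
  qed (rule comp_intros)
  have f: "computable (\<lambda>p. f (snd p))" by (rule computable_comp[OF fin]) (rule f_fix, assumption, intro comp_intros)
  have "(f ^^ k) a = a" if "\<not> fst a < n" for a k
    using f_fix[OF that] by (induction k) auto
  then have "fi a = a" if "\<not> fst a < n" for a
    using that by (simp add: fi_def)
  then have fi: "computable (\<lambda>p. fi (snd p))"
    by (intro computable_comp[OF fin[of fi]] comp_intros)
  let ?none = "\<lambda>x. if snd (fst x) = True then (map fi (fst (snd x)), (snd (snd x) + 1) mod m)
      else (map f (fst (snd x)), (snd (snd x) + mp) mod m)"
  let ?some = "\<lambda>x y. (lmul (y, snd (fst x)) (fst (snd x)), snd (snd x))"
  have lm: "computable (\<lambda>p. lmul (g p) (h p))" if "computable g" "computable h" for g h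
    using computable_comp[OF computable_lmul computable_Pair[OF that]] by simp
  have "computable (\<lambda>x. case fst (fst x) of None \<Rightarrow> ?none x | Some y \<Rightarrow> ?some x y)"
    by (rule computable_case_option; intro comp_intros lm f fi computable_mod)
  moreover have "(\<lambda>x. case fst (fst x) of None \<Rightarrow> ?none x | Some y \<Rightarrow> ?some x y) = (\<lambda>x. act (fst x) (snd x))"
  proof
    fix x :: "nat option letter \<times> nat letter list \<times> nat"
    show "(case fst (fst x) of None \<Rightarrow> ?none x | Some y \<Rightarrow> ?some x y) = act (fst x) (snd x)"
      by (cases "(fst x, snd x)" rule: act.cases) auto
  qed
  ultimately show ?thesis by (simp only:)
qed

theorem semidirect_conjugacy_problem_solvable:
  assumes f_fix: "\<And>a. \<not> fst a < n \<Longrightarrow> f a = a"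
  shows "conjugacy_problem_solvable G (semidirect_gens n)"
proof -
  have "finite (semidirect_gens n \<times> (UNIV :: bool set))" by (simp add: semidirect_gens_def)
  then obtain X where X: "set X = semidirect_gens n \<times> (UNIV :: bool set)"
    using finite_list by blast
  have over: "word_over (semidirect_gens n) w \<longleftrightarrow> set w \<subseteq> set X" for w
    by (auto simp: word_over_def X)
  \<comment> \<open>Exhaustive search over all conjugators within the bound. It is total on all
    pairs of words, as \<open>computable\<close> demands, but has a meaning only for words over the
    generators.\<close>
  define decide where "decide p = list_ex (\<lambda>w. ev (w @ fst p @ inv_word w @ inv_word (snd p)) = ([], 0))
    (words_upto X (conj_bound n (length (fst p)) (length (snd p)) + m))" for p
  have decide: "decide (u, v) \<longleftrightarrow> conjugate_words G (semidirect_gens n) u v"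
    if "word_over (semidirect_gens n) u" "word_over (semidirect_gens n) v" for u v
    unfolding conjugate_words_iff[OF that] decide_def
    by (auto simp: list_ex_iff set_words_upto over)
  have "computable decide"
    unfolding decide_def ev_def conj_bound_def power2_eq_square
    by (intro computable_list_ex computable_words_upto comp_intros computable_foldr[OF computable_act[OF f_fix]])
  then obtain r where r: "\<And>p. eval_recf r [enc p] (enc (decide p))"
    unfolding computable_def by blast
  have letter: "enc a = encode_letter a" for a :: "nat option letter"
    by (auto simp: encode_letter_def enc_prod_def enc_option_def enc_bool_def split: option.splits)
  have enc: "enc (u, v) = prod_encode (encode_word u, encode_word v)" for u v :: "nat option letter list"
    by (simp add: enc_prod_def enc_list_def encode_word_def letter[abs_def])
  show ?thesis
    unfolding conjugacy_problem_solvable_def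
  proof (intro exI[of _ r] allI impI)
    fix u v assume "word_over (semidirect_gens n) u" "word_over (semidirect_gens n) v"
    then show "eval_recf r [prod_encode (encode_word u, encode_word v)]
        (if conjugate_words G (semidirect_gens n) u v then 1 else 0)"
      using r[of "(u, v)"] decide by (simp add: enc enc_bool_def)
  qed
qed

end

theorem theorem3p8:
  fixes n m :: nat and E :: "nat \<Rightarrow> nat \<Rightarrow> bool" and phi :: "nat \<Rightarrow> nat letter list"
  assumes "simple_graph n E"
    and "raag_aut n E phi"
    and "length_preserving n E phi"
    and "aut_order n E phi m"
  shows "conjugacy_problem_solvable (semidirect_rels n E phi m) (semidirect_gens n)"
proof -
  interpret raag n E by unfold_locales (rule assms)
  have m: "0 < m" "aut_power_id n E phi m" using assms(4) by (auto simp: aut_order_def)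
  obtain s where s: "raag_symmetry n E s" "\<And>x. x < n \<Longrightarrow> pres_eq R (phi x) [s (x, True)]"
    "\<And>a. \<not> fst a < n \<Longrightarrow> s a = a" "\<And>a. (s ^^ m) a = a"
    using letter_permutation[OF assms(2,3) m(2)] by blast
  interpret raag_symmetry n E s by (rule s)
  interpret raag_semidirect n E s m phi
    by unfold_locales (use s m assms(2) in \<open>auto simp: raag_aut_def\<close>)
  show ?thesis using s(3) by (rule semidirect_conjugacy_problem_solvable)
qed

end
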